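(* Let $k$ be an algebraically closed field of characteristic zero and let $H$ be a finite dimensional semisimple Hopf algebra over $k$ with module structure $(1^a,n^b)$, i.e. $H$ has, up to isomorphism, precisely $a$ simple modules of dimension $1$ and precisely $b$ simple modules of dimension $n$ (with $n>1$), and no others. Then $H$ is of Knutson type.
   Context: A virtual $H$-module is an integer linear combination of simple $H$-modules, i.e. an element of the representation ring of $H$ (addition is direct sum, multiplication is tensor product via the comultiplication). The (left) Knutson Index $\mathcal{K}(M)$ of an $H$-module $M$ is the smallest integer $m\ge1$ such that $M\otimes N\cong m\,H$ (equality in the representation ring, with $H$ the regular module) for some virtual $H$-module $N$. $H$ is of Knutson type if $\mathcal{K}(M)=1$ for every simple $H$-module $M$. *)

theory Defs
  imports
    Jordan_Normal_Form.Matrix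
    "HOL-Library.Poly_Mapping"
    "HOL-Computational_Algebra.Group_Closure"
    "HOL-Computational_Algebra.Polynomial"
begin

section \<open>Tensor squares and cubes\<close>

text \<open>
  A finite sum of pure tensors is encoded as the list of its summands.  Two such sums are equal
  in the tensor square (cube) iff their images in the free abelian group on pairs (triples)
  differ by an element of the subgroup generated by the additivity and balancing relations.
\<close>

definition tensor2_relations ::
  "('k \<Rightarrow> 'h \<Rightarrow> 'h::ab_group_add) \<Rightarrow> ('h \<times> 'h \<Rightarrow>\<^sub>0 int) set" where
  "tensor2_relations scale =
     {frag_of (x + x', y) - frag_of (x, y) - frag_of (x', y) | x x' y. True} \<union>
     {frag_of (x, y + y') - frag_of (x, y) - frag_of (x, y') | x y y'. True} \<union>
     {frag_of (scale c x, y) - frag_of (x, scale c y) | c x y. True}"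

definition tensor3_relations ::
  "('k \<Rightarrow> 'h \<Rightarrow> 'h::ab_group_add) \<Rightarrow> ('h \<times> 'h \<times> 'h \<Rightarrow>\<^sub>0 int) set" where
  "tensor3_relations scale =
     {frag_of (x + x', y, z) - frag_of (x, y, z) - frag_of (x', y, z) | x x' y z. True} \<union>
     {frag_of (x, y + y', z) - frag_of (x, y, z) - frag_of (x, y', z) | x y y' z. True} \<union>
     {frag_of (x, y, z + z') - frag_of (x, y, z) - frag_of (x, y, z') | x y z z'. True} \<union>
     {frag_of (scale c x, y, z) - frag_of (x, scale c y, z) | c x y z. True} \<union>
     {frag_of (x, scale c y, z) - frag_of (x, y, scale c z) | c x y z. True}"

definition tensor2_eq ::
  "('k \<Rightarrow> 'h \<Rightarrow> 'h::ab_group_add) \<Rightarrow> ('h \<times> 'h) list \<Rightarrow> ('h \<times> 'h) list \<Rightarrow> bool" where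
  "tensor2_eq scale s t \<longleftrightarrow>
     (\<Sum>p\<leftarrow>s. frag_of p) - (\<Sum>p\<leftarrow>t. frag_of p) \<in> group_closure (tensor2_relations scale)"

definition tensor3_eq ::
  "('k \<Rightarrow> 'h \<Rightarrow> 'h::ab_group_add) \<Rightarrow> ('h \<times> 'h \<times> 'h) list \<Rightarrow> ('h \<times> 'h \<times> 'h) list \<Rightarrow> bool" where
  "tensor3_eq scale s t \<longleftrightarrow>
     (\<Sum>p\<leftarrow>s. frag_of p) - (\<Sum>p\<leftarrow>t. frag_of p) \<in> group_closure (tensor3_relations scale)"


section \<open>Hopf algebras\<close>

locale algebra_over = Vector_Spaces.vector_space scale
  for scale :: "'k::field \<Rightarrow> 'h::ring_1 \<Rightarrow> 'h" +
  assumes scale_mult_left: "scale c x * y = scale c (x * y)"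
    and scale_mult_right: "x * scale c y = scale c (x * y)"

text \<open>
  The list \<open>\<Delta> h\<close> is one chosen representative of the comultiplication of \<open>h\<close> (Sweedler notation:
  \<open>(a, b) \<leftarrow> \<Delta> h\<close> stands for the pair of tensor factors of a summand), so every axiom whose two
  sides lie in a tensor power is stated up to equality of tensors.  The symbols \<open>\<epsilon>\<close> and \<open>\<S>\<close> denote
  the counit and the antipode.
\<close>

locale hopf_algebra = algebra_over scale
  for scale :: "'k::field \<Rightarrow> 'h::ring_1 \<Rightarrow> 'h" +
  fixes \<Delta> :: "'h \<Rightarrow> ('h \<times> 'h) list"
    and \<epsilon> :: "'h \<Rightarrow> 'k"
    and \<S> :: "'h \<Rightarrow> 'h"
  assumes comult_add: "tensor2_eq scale (\<Delta> (x + y)) (\<Delta> x @ \<Delta> y)"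
    and comult_scale: "tensor2_eq scale (\<Delta> (scale c x)) [(scale c a, b). (a, b) \<leftarrow> \<Delta> x]"
    and comult_mult:
      "tensor2_eq scale (\<Delta> (x * y)) [(a * a', b * b'). (a, b) \<leftarrow> \<Delta> x, (a', b') \<leftarrow> \<Delta> y]"
    and comult_one: "tensor2_eq scale (\<Delta> 1) [(1, 1)]"
    and counit_linear: "Vector_Spaces.linear scale (*) \<epsilon>"
    and counit_mult: "\<epsilon> (x * y) = \<epsilon> x * \<epsilon> y"
    and counit_one: "\<epsilon> 1 = 1"
    and coassoc:
      "tensor3_eq scale [(a, a', b). (x', b) \<leftarrow> \<Delta> x, (a, a') \<leftarrow> \<Delta> x']
                        [(a, b, b'). (a, x') \<leftarrow> \<Delta> x, (b, b') \<leftarrow> \<Delta> x']"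
    and counit_left: "(\<Sum>(a, b)\<leftarrow>\<Delta> x. scale (\<epsilon> a) b) = x"
    and counit_right: "(\<Sum>(a, b)\<leftarrow>\<Delta> x. scale (\<epsilon> b) a) = x"
    and antipode_linear: "Vector_Spaces.linear scale scale \<S>"
    and antipode_left: "(\<Sum>(a, b)\<leftarrow>\<Delta> x. \<S> a * b) = scale (\<epsilon> x) 1"
    and antipode_right: "(\<Sum>(a, b)\<leftarrow>\<Delta> x. a * \<S> b) = scale (\<epsilon> x) 1"

locale fin_dim_hopf_algebra = hopf_algebra scale \<Delta> \<epsilon> \<S>
  for scale :: "'k::field \<Rightarrow> 'h::ring_1 \<Rightarrow> 'h" and \<Delta> \<epsilon> \<S> +
  assumes fin_dim: "\<exists>B. finite B \<and> span B = UNIV"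

definition left_ideal :: "'h::ring_1 set \<Rightarrow> bool" where
  "left_ideal I \<longleftrightarrow> 0 \<in> I \<and> (\<forall>x\<in>I. \<forall>y\<in>I. x + y \<in> I) \<and> (\<forall>h. \<forall>x\<in>I. h * x \<in> I)"

text \<open>
  Semisimplicity of the ring on the type \<open>'h\<close>: in the left regular module every submodule is a
  direct summand.
\<close>

definition semisimple_ring :: "'h::ring_1 itself \<Rightarrow> bool" where
  "semisimple_ring _ \<longleftrightarrow>
     (\<forall>I::'h set. left_ideal I \<longrightarrow>
        (\<exists>J. left_ideal J \<and> I \<inter> J = {0} \<and> (\<forall>h. \<exists>x\<in>I. \<exists>y\<in>J. h = x + y)))"


section \<open>Modules\<close>

text \<open>
  A finite-dimensional left module of dimension \<open>d\<close> is given, up to isomorphism, by the vector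
  space of column vectors of length \<open>d\<close> together with a homomorphism from the algebra to the
  \<open>d \<times> d\<close> matrices; \<open>d\<close> is recovered as the size of the image of \<open>1\<close> (and may be \<open>0\<close>).
\<close>

type_synonym ('h, 'k) rep = "'h \<Rightarrow> 'k mat"

definition rdim :: "('h::one, 'k) rep \<Rightarrow> nat" where
  "rdim \<rho> = dim_row (\<rho> 1)"

definition rep_iso :: "('h::one, 'k::field) rep \<Rightarrow> ('h, 'k) rep \<Rightarrow> bool" where
  "rep_iso \<rho> \<sigma> \<longleftrightarrow> rdim \<sigma> = rdim \<rho> \<and>
     (\<exists>P\<in>carrier_mat (rdim \<rho>) (rdim \<rho>). invertible_mat P \<and> (\<forall>h. P * \<rho> h = \<sigma> h * P))"

definition rep_sum :: "('h::one, 'k::field) rep \<Rightarrow> ('h, 'k) rep \<Rightarrow> ('h, 'k) rep" where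
  "rep_sum \<rho> \<sigma> h =
     four_block_mat (\<rho> h) (0\<^sub>m (rdim \<rho>) (rdim \<sigma>)) (0\<^sub>m (rdim \<sigma>) (rdim \<rho>)) (\<sigma> h)"

definition kronecker :: "'k::field mat \<Rightarrow> 'k mat \<Rightarrow> 'k mat" where
  "kronecker A B = mat (dim_row A * dim_row B) (dim_col A * dim_col B)
     (\<lambda>(i, j). A $$ (i div dim_row B, j div dim_col B) * B $$ (i mod dim_row B, j mod dim_col B))"

definition submodule :: "('h::one, 'k::field) rep \<Rightarrow> 'k vec set \<Rightarrow> bool" where
  "submodule \<rho> W \<longleftrightarrow>
     W \<subseteq> carrier_vec (rdim \<rho>) \<and> 0\<^sub>v (rdim \<rho>) \<in> W \<and>
     (\<forall>v\<in>W. \<forall>w\<in>W. v + w \<in> W) \<and> (\<forall>c. \<forall>v\<in>W. c \<cdot>\<^sub>v v \<in> W) \<and> (\<forall>h. \<forall>v\<in>W. \<rho> h *\<^sub>v v \<in> W)"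

context algebra_over
begin

definition is_module :: "('h, 'k) rep \<Rightarrow> bool" where
  "is_module \<rho> \<longleftrightarrow>
     (\<forall>h. \<rho> h \<in> carrier_mat (rdim \<rho>) (rdim \<rho>)) \<and>
     (\<forall>x y. \<rho> (x + y) = \<rho> x + \<rho> y) \<and>
     (\<forall>c x. \<rho> (scale c x) = c \<cdot>\<^sub>m \<rho> x) \<and>
     (\<forall>x y. \<rho> (x * y) = \<rho> x * \<rho> y) \<and>
     \<rho> 1 = 1\<^sub>m (rdim \<rho>)"

definition simple_module :: "('h, 'k) rep \<Rightarrow> bool" where
  "simple_module \<rho> \<longleftrightarrow> is_module \<rho> \<and> rdim \<rho> \<noteq> 0 \<and>
     (\<forall>W. submodule \<rho> W \<longrightarrow> W = {0\<^sub>v (rdim \<rho>)} \<or> W = carrier_vec (rdim \<rho>))"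

definition simple_classes :: "nat \<Rightarrow> ('h, 'k) rep set set" where
  "simple_classes d = {\<rho>. simple_module \<rho> \<and> rdim \<rho> = d} //
     {(\<rho>, \<sigma>). is_module \<rho> \<and> is_module \<sigma> \<and> rep_iso \<rho> \<sigma>}"

text \<open>Module structure \<open>(1\<^sup>a, n\<^sup>b)\<close>:\<close>

definition module_structure :: "nat \<Rightarrow> nat \<Rightarrow> nat \<Rightarrow> bool" where
  "module_structure a n b \<longleftrightarrow>
     finite (simple_classes 1) \<and> card (simple_classes 1) = a \<and>
     finite (simple_classes n) \<and> card (simple_classes n) = b \<and>
     (\<forall>\<rho>. simple_module \<rho> \<longrightarrow> rdim \<rho> = 1 \<or> rdim \<rho> = n)"

text \<open>
  The left regular module, written in some ordered basis of the algebra; a basis of this kind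
  exists exactly if the algebra is finite-dimensional.
\<close>

definition basis_list :: "'h list" where
  "basis_list = (SOME bs. distinct bs \<and> independent (set bs) \<and> span (set bs) = UNIV)"

definition regular :: "('h, 'k) rep" where
  "regular h = mat (length basis_list) (length basis_list)
     (\<lambda>(i, j). representation (set basis_list) (h * basis_list ! j) (basis_list ! i))"

end


section \<open>The representation ring and the Knutson index\<close>

context hopf_algebra
begin

text \<open>The action of \<open>h\<close> on a tensor product is the sum of \<open>\<rho> a \<otimes> \<sigma> b\<close> over the summands of \<open>\<Delta> h\<close>.\<close>

definition rep_tensor :: "('h, 'k) rep \<Rightarrow> ('h, 'k) rep \<Rightarrow> ('h, 'k) rep" where
  "rep_tensor \<rho> \<sigma> h = mat (rdim \<rho> * rdim \<sigma>) (rdim \<rho> * rdim \<sigma>)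
     (\<lambda>ij. \<Sum>(a, b)\<leftarrow>\<Delta> h. kronecker (\<rho> a) (\<sigma> b) $$ ij)"

text \<open>
  Elements of the representation ring are represented by integer combinations of modules, with
  equality modulo the relations that identify isomorphic modules and make direct sum the addition.
\<close>

definition rep_ring_relations :: "(('h, 'k) rep \<Rightarrow>\<^sub>0 int) set" where
  "rep_ring_relations =
     {frag_of \<rho> - frag_of \<sigma> | \<rho> \<sigma>. is_module \<rho> \<and> is_module \<sigma> \<and> rep_iso \<rho> \<sigma>} \<union>
     {frag_of (rep_sum \<rho> \<sigma>) - frag_of \<rho> - frag_of \<sigma> | \<rho> \<sigma>. is_module \<rho> \<and> is_module \<sigma>}"

definition rep_ring_eq :: "(('h, 'k) rep \<Rightarrow>\<^sub>0 int) \<Rightarrow> (('h, 'k) rep \<Rightarrow>\<^sub>0 int) \<Rightarrow> bool" where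
  "rep_ring_eq x y \<longleftrightarrow> x - y \<in> group_closure rep_ring_relations"

definition rep_ring_mult ::
  "(('h, 'k) rep \<Rightarrow>\<^sub>0 int) \<Rightarrow> (('h, 'k) rep \<Rightarrow>\<^sub>0 int) \<Rightarrow> (('h, 'k) rep \<Rightarrow>\<^sub>0 int)" where
  "rep_ring_mult x y =
     frag_extend (\<lambda>\<rho>. frag_extend (\<lambda>\<sigma>. frag_of (rep_tensor \<rho> \<sigma>)) y) x"

definition virtual_module :: "(('h, 'k) rep \<Rightarrow>\<^sub>0 int) \<Rightarrow> bool" where
  "virtual_module x \<longleftrightarrow> (\<forall>\<rho>\<in>Poly_Mapping.keys x. simple_module \<rho>)"

text \<open>
  The set of admissible \<open>m\<close> is not empty in the finite-dimensional semisimple case: the tensor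
  product of a nonzero module \<open>\<rho>\<close> with the regular module is a sum of \<open>rdim \<rho>\<close> copies of the
  regular module, which is itself a sum of simple modules.
\<close>

definition knutson_index :: "('h, 'k) rep \<Rightarrow> nat" where
  "knutson_index \<rho> =
     (LEAST m. 1 \<le> m \<and>
        (\<exists>N. virtual_module N \<and>
             rep_ring_eq (rep_ring_mult (frag_of \<rho>) N) (frag_cmul (int m) (frag_of regular))))"

definition knutson_type :: bool where
  "knutson_type \<longleftrightarrow> (\<forall>\<rho>. simple_module \<rho> \<longrightarrow> knutson_index \<rho> = 1)"

end

end

theory Submission
  imports Defs "Jordan_Normal_Form.Char_Poly"
begin

text \<open>
  Write \<open>[W : U]\<close> for the multiplicity of the simple module \<open>U\<close> in \<open>W\<close>, and let \<open>V\<close> range over the simple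
  modules up to isomorphism.  The regular module is the sum of the \<open>V\<close> with multiplicities \<open>dim V\<close>, so
  for a simple module \<open>M\<close> it suffices to find natural numbers \<open>k V\<close> with
  \<open>\<Sum>V. k V * [M \<otimes> V : U] = dim U\<close> for every \<open>U\<close>; this is lemma \<open>knutson_index_eq_1I\<close>.  The point of
  departure is the identity

    \<open>\<Sum>V. dim V * [M \<otimes> V : U] = dim M * dim U\<close>

  (lemma \<open>multiplicity_tensor_sum\<close>): by adjunction \<open>[M \<otimes> V : U]\<close> equals \<open>[M\<^sup>* \<otimes> U : V]\<close>, and the left-hand
  side becomes the dimension of \<open>M\<^sup>* \<otimes> U\<close>.

  If \<open>dim M = 1\<close>, then \<open>k V = dim V\<close> works.  If \<open>dim M = n\<close>, then \<open>M \<otimes> X\<close> is simple for each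
  one-dimensional \<open>X\<close>.  Let \<open>d U\<close> be the number of those \<open>X\<close> with \<open>M \<otimes> X \<cong> U\<close>.  As all other simple modules
  have dimension \<open>n\<close>, the identity reads \<open>d U + n * (\<Sum>V. [M \<otimes> V : U]) = n * dim U\<close>, with the sum over the \<open>V\<close>
  of dimension \<open>n\<close>.  Hence \<open>n\<close> divides \<open>d U\<close>, and one may take \<open>k V = 1\<close> for the \<open>V\<close> of dimension \<open>n\<close> and, for
  each \<open>U\<close> with \<open>d U > 0\<close>, give the weight \<open>d U / n\<close> to a single \<open>X\<close> with \<open>M \<otimes> X \<cong> U\<close>.

  Multiplicities are computed in the ground field.  Semisimplicity yields a left integral \<open>\<Lambda>\<close> with
  \<open>\<epsilon> \<Lambda> = 1\<close>, and \<open>P \<mapsto> \<Sum> \<sigma> \<Lambda>\<^sub>1 P \<rho> (\<S> \<Lambda>\<^sub>2)\<close> projects the linear maps from \<open>\<rho>\<close> to \<open>\<sigma>\<close> onto the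
  homomorphisms.  Its trace, the pairing of \<open>\<rho>\<close> and \<open>\<sigma>\<close>, depends only on the two characters, hence is
  additive and invariant under isomorphism, and on simple modules it is \<open>0\<close> or \<open>1\<close> by Schur's lemma.
  Since the characteristic is \<open>0\<close>, it determines the multiplicities.  Spaces of homomorphisms are compared
  without bases: idempotent operators with the same image have the same trace (lemma
  \<open>idempotent_trace_eq\<close>).  The same averaging gives complete reducibility, as in Maschke's theorem.
\<close>

section \<open>Balanced maps and sums over the coproduct\<close>

text \<open>
  The additive extension of \<open>f\<close> to the free abelian group.  The codomain is a ring, so that integer
  coefficients act by multiplication.
\<close>

definition frag_eval :: "('a \<Rightarrow> 'v::ring_1) \<Rightarrow> ('a \<Rightarrow>\<^sub>0 int) \<Rightarrow> 'v" where
  "frag_eval f x = (\<Sum>a\<in>Poly_Mapping.keys x. of_int (Poly_Mapping.lookup x a) * f a)"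

lemma frag_eval_superset:
  assumes "finite A" "Poly_Mapping.keys x \<subseteq> A"
  shows "frag_eval f x = (\<Sum>a\<in>A. of_int (Poly_Mapping.lookup x a) * f a)"
  unfolding frag_eval_def
  by (rule sum.mono_neutral_left) (use assms in \<open>auto simp: in_keys_iff\<close>)

lemma frag_eval_diff: "frag_eval f (x - y) = frag_eval f x - frag_eval f y"
proof -
  let ?A = "Poly_Mapping.keys x \<union> Poly_Mapping.keys y"
  have "Poly_Mapping.keys (x - y) \<subseteq> ?A"
    by (auto simp: in_keys_iff lookup_minus)
  then show ?thesis
    by (simp add: frag_eval_superset[of ?A] lookup_minus left_diff_distrib sum_subtractf)
qed

lemma frag_eval_0 [simp]: "frag_eval f 0 = 0"
  by (simp add: frag_eval_def)

lemma frag_eval_of [simp]: "frag_eval f (frag_of a) = f a"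
  by (simp add: frag_eval_def)

lemma frag_eval_add: "frag_eval f (x + y) = frag_eval f x + frag_eval f y"
  using frag_eval_diff[of f "x + y" y] by simp

lemma frag_eval_sum_list: "frag_eval f (\<Sum>p\<leftarrow>s. frag_of p) = (\<Sum>p\<leftarrow>s. f p)"
  by (induction s) (simp_all add: frag_eval_add)

lemma frag_eval_closure:
  assumes "x \<in> group_closure S" "\<And>s. s \<in> S \<Longrightarrow> frag_eval f s = 0"
  shows "frag_eval f x = 0"
  using assms(1) by (induction rule: group_closure.induct) (auto simp: frag_eval_diff assms(2))

lemma sum_list_concat_map:
  "sum_list (map f (concat xss)) = (\<Sum>xs\<leftarrow>xss. sum_list (map f xs))"
  for f :: "'x \<Rightarrow> 'v::comm_monoid_add"
  by (induction xss) simp_all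

context algebra_over
begin

text \<open>
  These are the maps that factor through the tensor square over the field.  The codomain may be the
  field or the algebra.
\<close>

definition balanced :: "('h \<Rightarrow> 'h \<Rightarrow> 'v::ring_1) \<Rightarrow> bool" where
  "balanced F \<longleftrightarrow>
     (\<forall>x x' y. F (x + x') y = F x y + F x' y) \<and>
     (\<forall>x y y'. F x (y + y') = F x y + F x y') \<and>
     (\<forall>c x y. F (scale c x) y = F x (scale c y))"

definition balanced3 :: "('h \<Rightarrow> 'h \<Rightarrow> 'h \<Rightarrow> 'v::ring_1) \<Rightarrow> bool" where
  "balanced3 G \<longleftrightarrow> (\<forall>z. balanced (\<lambda>x y. G x y z)) \<and> (\<forall>x. balanced (G x))"

text \<open>
  The additive extension of a balanced map vanishes on the generators of the tensor relations, hence on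
  the subgroup generated by them.
\<close>

lemma tensor2_eq_eval:
  assumes "tensor2_eq scale s t" "balanced F"
  shows "(\<Sum>(a, b)\<leftarrow>s. F a b) = (\<Sum>(a, b)\<leftarrow>t. F a b)"
proof -
  have "frag_eval (case_prod F) ((\<Sum>p\<leftarrow>s. frag_of p) - (\<Sum>p\<leftarrow>t. frag_of p)) = 0"
    using assms(1) unfolding tensor2_eq_def
    by (rule frag_eval_closure)
      (use assms(2) in \<open>auto simp: tensor2_relations_def frag_eval_diff balanced_def\<close>)
  then show ?thesis by (simp add: frag_eval_diff frag_eval_sum_list)
qed

lemma tensor3_eq_eval:
  assumes "tensor3_eq scale s t" "balanced3 G"
  shows "(\<Sum>(a, b, c)\<leftarrow>s. G a b c) = (\<Sum>(a, b, c)\<leftarrow>t. G a b c)"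
proof -
  let ?f = "\<lambda>(a, b, c). G a b c"
  have "frag_eval ?f ((\<Sum>p\<leftarrow>s. frag_of p) - (\<Sum>p\<leftarrow>t. frag_of p)) = 0"
    using assms(1) unfolding tensor3_eq_def
    by (rule frag_eval_closure)
      (use assms(2) in \<open>auto simp: tensor3_relations_def frag_eval_diff balanced3_def balanced_def\<close>)
  then show ?thesis by (simp add: frag_eval_diff frag_eval_sum_list)
qed

lemma balanced_scale_one: "balanced F \<Longrightarrow> F (scale c 1) = (\<lambda>x. F 1 (scale c x))"
  by (simp add: balanced_def fun_eq_iff)

end

context hopf_algebra
begin

text \<open>
  \<open>sweedler h F\<close> is \<open>\<Sum> F h\<^sub>1 h\<^sub>2\<close> in Sweedler notation.  For balanced \<open>F\<close> it depends only on the
  coproduct as a tensor, not on the representative \<open>\<Delta> h\<close>.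
\<close>

definition sweedler :: "'h \<Rightarrow> ('h \<Rightarrow> 'h \<Rightarrow> 'v::comm_monoid_add) \<Rightarrow> 'v" where
  "sweedler h F = (\<Sum>(a, b)\<leftarrow>\<Delta> h. F a b)"

lemma sweedler_add:
  "balanced F \<Longrightarrow> sweedler (x + y) F = sweedler x F + sweedler y F"
  using tensor2_eq_eval[OF comult_add, of F] by (simp add: sweedler_def)

lemma sweedler_scale:
  assumes "balanced F"
  shows "sweedler (scale c x) F = sweedler x (\<lambda>a b. F (scale c a) b)"
  using tensor2_eq_eval[OF comult_scale assms] 
  by (simp add: sweedler_def comp_def case_prod_unfold)

lemma sweedler_mult:
  assumes "balanced F"
  shows "sweedler (x * y) F = sweedler x (\<lambda>a b. sweedler y (\<lambda>a' b'. F (a * a') (b * b')))"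
  using tensor2_eq_eval[OF comult_mult assms]
  by (simp add: sweedler_def sum_list_concat_map comp_def case_prod_unfold)

lemma sweedler_one: "balanced F \<Longrightarrow> sweedler 1 F = F 1 1"
  using tensor2_eq_eval[OF comult_one, of F] by (simp add: sweedler_def)

lemma sweedler_coassoc:
  assumes "balanced3 G"
  shows "sweedler h (\<lambda>a b. sweedler a (\<lambda>a\<^sub>1 a\<^sub>2. G a\<^sub>1 a\<^sub>2 b)) =
    sweedler h (\<lambda>a b. sweedler b (\<lambda>b\<^sub>1 b\<^sub>2. G a b\<^sub>1 b\<^sub>2))"
  using tensor3_eq_eval[OF coassoc assms]
  by (simp add: sweedler_def sum_list_concat_map comp_def case_prod_unfold)

lemma sweedler_hom:
  fixes f :: "'v::ab_group_add \<Rightarrow> 'w::ab_group_add"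
  assumes "\<And>x y. f (x + y) = f x + f y"
  shows "f (sweedler h F) = sweedler h (\<lambda>a b. f (F a b))"
proof -
  have "f 0 = 0" using assms[of 0 0] by simp
  moreover have "f (\<Sum>(a, b)\<leftarrow>xs. F a b) = (\<Sum>(a, b)\<leftarrow>xs. f (F a b))" for xs
    by (induction xs) (auto simp: assms \<open>f 0 = 0\<close>)
  ultimately show ?thesis by (simp add: sweedler_def)
qed

lemma sweedler_plus: "sweedler h (\<lambda>a b. F a b + G a b) = sweedler h F + sweedler h G"
proof -
  have "(\<Sum>(a, b)\<leftarrow>xs. F a b + G a b) = (\<Sum>(a, b)\<leftarrow>xs. F a b) + (\<Sum>(a, b)\<leftarrow>xs. G a b)" for xs
    by (induction xs) (auto simp: ac_simps)
  then show ?thesis by (simp add: sweedler_def)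
qed

lemma sweedler_zero: "sweedler h (\<lambda>a b. 0) = 0"
  by (simp add: sweedler_def case_prod_unfold)

lemma sweedler_sum: "sweedler h (\<lambda>a b. \<Sum>i\<in>I. F i a b) = (\<Sum>i\<in>I. sweedler h (F i))"
  by (induction I rule: infinite_finite_induct) (simp_all add: sweedler_plus sweedler_zero)

lemma sweedler_cmult: "sweedler h (\<lambda>a b. c * F a b) = c * sweedler h F"
  for c :: "'v::ring_1"
  by (rule sweedler_hom[symmetric]) (rule distrib_left)

lemma sweedler_cmult_right: "sweedler h (\<lambda>a b. F a b * c) = sweedler h F * c"
  for c :: "'v::ring_1"
  by (rule sweedler_hom[symmetric]) (rule distrib_right)

lemma sweedler_product:
  fixes F G :: "'h \<Rightarrow> 'h \<Rightarrow> 'k"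
  shows "sweedler x F * sweedler y G = sweedler x (\<lambda>a b. sweedler y (\<lambda>c d. F a b * G c d))"
  by (simp add: sweedler_cmult sweedler_cmult_right)

lemma sweedler_commute:
  "sweedler h (\<lambda>a b. sweedler g (\<lambda>c d. F a b c d)) = sweedler g (\<lambda>c d. sweedler h (\<lambda>a b. F a b c d))"
proof -
  have "(\<Sum>(a, b)\<leftarrow>xs. \<Sum>(c, d)\<leftarrow>ys. F a b c d) = (\<Sum>(c, d)\<leftarrow>ys. \<Sum>(a, b)\<leftarrow>xs. F a b c d)" for xs ys
  proof (induction xs)
    case Nil
    then show ?case by (simp add: case_prod_unfold)
  next
    case (Cons p xs)
    have "(\<Sum>(c, d)\<leftarrow>ys. F (fst p) (snd p) c d) + (\<Sum>(c, d)\<leftarrow>ys. \<Sum>(a, b)\<leftarrow>xs. F a b c d)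
      = (\<Sum>(c, d)\<leftarrow>ys. F (fst p) (snd p) c d + (\<Sum>(a, b)\<leftarrow>xs. F a b c d))"
      by (induction ys) (auto simp: ac_simps)
    then show ?case using Cons by (simp add: case_prod_unfold)
  qed
  then show ?thesis by (simp add: sweedler_def)
qed

lemma antipode_add: "\<S> (x + y) = \<S> x + \<S> y"
  and antipode_scale: "\<S> (scale c x) = scale c (\<S> x)"
  and counit_add: "\<epsilon> (x + y) = \<epsilon> x + \<epsilon> y"
  and counit_scale: "\<epsilon> (scale c x) = c * \<epsilon> x"
proof -
  have "module_hom scale scale \<S>" "module_hom scale (*) \<epsilon>"
    using antipode_linear counit_linear by (auto simp only: Vector_Spaces.linear_def)
  then show "\<S> (x + y) = \<S> x + \<S> y" "\<S> (scale c x) = scale c (\<S> x)"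
    "\<epsilon> (x + y) = \<epsilon> x + \<epsilon> y" "\<epsilon> (scale c x) = c * \<epsilon> x"
    by (simp_all only: module_hom.add module_hom.scale)
qed

lemmas balanced_simps =
  balanced_def balanced3_def antipode_add antipode_scale counit_add counit_scale
  distrib_left distrib_right scale_mult_left scale_mult_right scale_left_distrib scale_right_distrib

lemma sweedler_counit_left:
  fixes f :: "'h \<Rightarrow> 'v::ab_group_add"
  assumes "\<And>x y. f (x + y) = f x + f y"
  shows "sweedler h (\<lambda>a b. f (scale (\<epsilon> a) b)) = f h"
  using counit_left[of h] sweedler_hom[of f, OF assms, of h "\<lambda>a b. scale (\<epsilon> a) b"]
  by (simp add: sweedler_def)

lemma sweedler_counit_right:
  fixes f :: "'h \<Rightarrow> 'v::ab_group_add"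
  assumes "\<And>x y. f (x + y) = f x + f y"
  shows "sweedler h (\<lambda>a b. f (scale (\<epsilon> b) a)) = f h"
  using counit_right[of h] sweedler_hom[of f, OF assms, of h "\<lambda>a b. scale (\<epsilon> b) a"]
  by (simp add: sweedler_def)

lemma sweedler_antipode_left:
  fixes f :: "'h \<Rightarrow> 'v::ab_group_add"
  assumes "\<And>x y. f (x + y) = f x + f y"
  shows "sweedler h (\<lambda>a b. f (\<S> a * b)) = f (scale (\<epsilon> h) 1)"
  using antipode_left[of h] sweedler_hom[of f, OF assms, of h "\<lambda>a b. \<S> a * b"]
  by (simp add: sweedler_def)

lemma sweedler_antipode_right:
  fixes f :: "'h \<Rightarrow> 'v::ab_group_add"
  assumes "\<And>x y. f (x + y) = f x + f y"
  shows "sweedler h (\<lambda>a b. f (a * \<S> b)) = f (scale (\<epsilon> h) 1)"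
  using antipode_right[of h] sweedler_hom[of f, OF assms, of h "\<lambda>a b. a * \<S> b"]
  by (simp add: sweedler_def)

text \<open>
  The antipode axioms and coassociativity give \<open>\<S> h\<^sub>1 h\<^sub>2 \<otimes> h\<^sub>3 = 1 \<otimes> h\<close>; the next two lemmas are the
  variants \<open>h\<^sub>1 \<S> h\<^sub>2 \<otimes> h\<^sub>3 = 1 \<otimes> h\<close> and \<open>h\<^sub>1 \<otimes> h\<^sub>2 \<S> h\<^sub>3 = h \<otimes> 1\<close>.
\<close>

lemma sweedler_cancel_left:
  assumes "balanced F"
  shows "sweedler h (\<lambda>a b. sweedler b (\<lambda>b\<^sub>1 b\<^sub>2. F (\<S> a * b\<^sub>1) b\<^sub>2)) = F 1 h"
proof -
  have "balanced3 (\<lambda>a b c. F (\<S> a * b) c)"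
    using assms by (simp add: balanced_simps)
  then have "sweedler h (\<lambda>a b. sweedler b (\<lambda>b\<^sub>1 b\<^sub>2. F (\<S> a * b\<^sub>1) b\<^sub>2))
    = sweedler h (\<lambda>a b. sweedler a (\<lambda>a\<^sub>1 a\<^sub>2. F (\<S> a\<^sub>1 * a\<^sub>2) b))"
    by (rule sweedler_coassoc[symmetric])
  also have "\<dots> = sweedler h (\<lambda>a b. F 1 (scale (\<epsilon> a) b))"
    using assms
    by (subst sweedler_antipode_left) (simp_all add: balanced_scale_one, simp_all add: balanced_def)
  also have "\<dots> = F 1 h"
    using assms by (subst sweedler_counit_left) (simp_all add: balanced_def)
  finally show ?thesis .
qed

lemma sweedler_cancel_right:
  assumes "balanced F"
  shows "sweedler h (\<lambda>a b. sweedler b (\<lambda>b\<^sub>1 b\<^sub>2. F (a * \<S> b\<^sub>1) b\<^sub>2)) = F 1 h"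
proof -
  have "balanced3 (\<lambda>a b c. F (a * \<S> b) c)"
    using assms by (simp add: balanced_simps)
  then have "sweedler h (\<lambda>a b. sweedler b (\<lambda>b\<^sub>1 b\<^sub>2. F (a * \<S> b\<^sub>1) b\<^sub>2))
    = sweedler h (\<lambda>a b. sweedler a (\<lambda>a\<^sub>1 a\<^sub>2. F (a\<^sub>1 * \<S> a\<^sub>2) b))"
    by (rule sweedler_coassoc[symmetric])
  also have "\<dots> = sweedler h (\<lambda>a b. F 1 (scale (\<epsilon> a) b))"
    using assms
    by (subst sweedler_antipode_right) (simp_all add: balanced_scale_one, simp_all add: balanced_def)
  also have "\<dots> = F 1 h"
    using assms by (subst sweedler_counit_left) (simp_all add: balanced_def)
  finally show ?thesis .
qed

lemma sweedler_split_antipode_right: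
  assumes "balanced F"
  shows "sweedler h (\<lambda>a b. sweedler a (\<lambda>a\<^sub>1 a\<^sub>2. F a\<^sub>1 (a\<^sub>2 * \<S> b))) = F h 1"
proof -
  have "balanced3 (\<lambda>a b c. F a (b * \<S> c))"
    using assms by (simp add: balanced_simps)
  then have "sweedler h (\<lambda>a b. sweedler a (\<lambda>a\<^sub>1 a\<^sub>2. F a\<^sub>1 (a\<^sub>2 * \<S> b)))
    = sweedler h (\<lambda>a b. sweedler b (\<lambda>b\<^sub>1 b\<^sub>2. F a (b\<^sub>1 * \<S> b\<^sub>2)))"
    by (rule sweedler_coassoc)
  also have "\<dots> = sweedler h (\<lambda>a b. F (scale (\<epsilon> b) a) 1)"
    using assms by (subst sweedler_antipode_right) (simp_all add: balanced_def)
  also have "\<dots> = F h 1"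
    using assms by (subst sweedler_counit_right) (simp_all add: balanced_def)
  finally show ?thesis .
qed

lemma antipode_one: "\<S> 1 = 1"
  using sweedler_antipode_left[of id 1] sweedler_one[of "\<lambda>a b. \<S> a * b"]
  by (simp add: balanced_simps counit_one)

text \<open>
  The antipode reverses products because \<open>\<S> (x y)\<close> and \<open>\<S> y \<S> x\<close> are both convolution inverses of
  the multiplication.
\<close>

lemma antipode_mult: "\<S> (x * y) = \<S> y * \<S> x"
proof -
  \<comment> \<open>Insert \<open>x\<^sub>2 y\<^sub>2 \<S> (x\<^sub>3 y\<^sub>3)\<close>, which sums to a counit, to the right of \<open>\<S> y\<^sub>1 \<S> x\<^sub>1\<close>; then
    \<open>\<S> x\<^sub>1 x\<^sub>2\<close> and \<open>\<S> y\<^sub>1 y\<^sub>2\<close> cancel.\<close>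
  have "\<S> y * \<S> x = sweedler x (\<lambda>x\<^sub>1 x\<^sub>2. \<S> y * \<S> (scale (\<epsilon> x\<^sub>2) x\<^sub>1))"
    by (subst sweedler_counit_right) (simp_all add: balanced_simps)
  also have "\<dots> = sweedler x (\<lambda>x\<^sub>1 x\<^sub>2. sweedler y (\<lambda>y\<^sub>1 y\<^sub>2.
      \<S> (scale (\<epsilon> y\<^sub>2) y\<^sub>1) * \<S> (scale (\<epsilon> x\<^sub>2) x\<^sub>1)))"
    by (subst sweedler_counit_right) (simp_all add: balanced_simps)
  also have "\<dots> = sweedler x (\<lambda>x\<^sub>1 x\<^sub>2. sweedler y (\<lambda>y\<^sub>1 y\<^sub>2.
      \<S> y\<^sub>1 * \<S> x\<^sub>1 * scale (\<epsilon> (x\<^sub>2 * y\<^sub>2)) 1))"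
    by (simp add: balanced_simps counit_mult mult.commute)
  also have "\<dots> = sweedler x (\<lambda>x\<^sub>1 x\<^sub>2. sweedler y (\<lambda>y\<^sub>1 y\<^sub>2.
      sweedler (x\<^sub>2 * y\<^sub>2) (\<lambda>c d. \<S> y\<^sub>1 * \<S> x\<^sub>1 * (c * \<S> d))))"
    by (subst sweedler_antipode_right) (simp_all add: balanced_simps)
  also have "\<dots> = sweedler x (\<lambda>x\<^sub>1 x\<^sub>2. sweedler y (\<lambda>y\<^sub>1 y\<^sub>2. sweedler x\<^sub>2 (\<lambda>x\<^sub>3 x\<^sub>4. sweedler y\<^sub>2 (\<lambda>y\<^sub>3 y\<^sub>4.
      \<S> y\<^sub>1 * \<S> x\<^sub>1 * (x\<^sub>3 * y\<^sub>3 * \<S> (x\<^sub>4 * y\<^sub>4))))))"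
    by (subst sweedler_mult) (simp_all add: balanced_simps)
  also have "\<dots> = sweedler y (\<lambda>y\<^sub>1 y\<^sub>2. sweedler y\<^sub>2 (\<lambda>y\<^sub>3 y\<^sub>4. sweedler x (\<lambda>x\<^sub>1 x\<^sub>2. sweedler x\<^sub>2 (\<lambda>x\<^sub>3 x\<^sub>4.
      \<S> y\<^sub>1 * (\<S> x\<^sub>1 * x\<^sub>3) * y\<^sub>3 * \<S> (x\<^sub>4 * y\<^sub>4)))))"
    by (subst sweedler_commute, subst (2) sweedler_commute, subst (3) sweedler_commute)
      (simp add: mult.assoc)
  also have "\<dots> = sweedler y (\<lambda>y\<^sub>1 y\<^sub>2. sweedler y\<^sub>2 (\<lambda>y\<^sub>3 y\<^sub>4. (\<S> y\<^sub>1 * y\<^sub>3) * \<S> (x * y\<^sub>4)))"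
    by (subst sweedler_cancel_left) (simp_all add: balanced_simps)
  also have "\<dots> = \<S> (x * y)"
    by (subst sweedler_cancel_left) (simp_all add: balanced_simps)
  finally show ?thesis by simp
qed

end

section \<open>The normalised integral\<close>

context hopf_algebra
begin

text \<open>
  An element acting from the left on the first leg of the integral can be moved to the right of the
  antipode of the second leg.  This makes the average of a linear map over the integral a homomorphism.
\<close>

lemma integral_transfer:
  assumes int: "\<And>h. h * L = scale (\<epsilon> h) L" and F: "balanced F"
  shows "sweedler L (\<lambda>a b. F (h * a) (\<S> b)) = sweedler L (\<lambda>a b. F a (\<S> b * h))"
proof -
  note bF = F[unfolded balanced_def]
  \<comment> \<open>In Sweedler notation: \<open>h a \<otimes> \<S> b = h\<^sub>1 a \<otimes> \<S> b \<S> h\<^sub>2 h\<^sub>3 = h\<^sub>1 a \<otimes> \<S> (h\<^sub>2 b) h\<^sub>3\<close>, and \<open>h\<^sub>1 a \<otimes> h\<^sub>2 b\<close> is the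
    coproduct of \<open>h\<^sub>1 L = \<epsilon> h\<^sub>1 L\<close>.\<close>
  have "sweedler L (\<lambda>a b. F (h * a) (\<S> b)) =
      sweedler h (\<lambda>h\<^sub>1 h\<^sub>2. sweedler L (\<lambda>a b. F (scale (\<epsilon> h\<^sub>2) h\<^sub>1 * a) (\<S> b)))"
    by (subst sweedler_counit_right) (simp_all add: bF balanced_simps sweedler_plus)
  also have "\<dots> = sweedler h (\<lambda>h\<^sub>1 h\<^sub>2. sweedler L (\<lambda>a b. F (h\<^sub>1 * a) (\<S> b * scale (\<epsilon> h\<^sub>2) 1)))"
    using bF by (simp add: balanced_simps)
  also have "\<dots> = sweedler h (\<lambda>h\<^sub>1 h\<^sub>2. sweedler h\<^sub>2 (\<lambda>h\<^sub>3 h\<^sub>4.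
      sweedler L (\<lambda>a b. F (h\<^sub>1 * a) (\<S> b * (\<S> h\<^sub>3 * h\<^sub>4)))))"
    by (subst sweedler_antipode_left) (simp_all add: bF balanced_simps sweedler_plus)
  also have "\<dots> = sweedler h (\<lambda>h\<^sub>1 h\<^sub>2. sweedler h\<^sub>1 (\<lambda>h\<^sub>3 h\<^sub>4.
      sweedler L (\<lambda>a b. F (h\<^sub>3 * a) (\<S> b * (\<S> h\<^sub>4 * h\<^sub>2)))))"
    by (rule sweedler_coassoc[symmetric]) (simp add: bF balanced_simps sweedler_plus)
  also have "\<dots> = sweedler h (\<lambda>h\<^sub>1 h\<^sub>2. sweedler (h\<^sub>1 * L) (\<lambda>a b. F a (\<S> b * h\<^sub>2)))"
    by (subst sweedler_mult) (simp_all add: bF balanced_simps antipode_mult mult.assoc)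
  also have "\<dots> = sweedler h (\<lambda>h\<^sub>1 h\<^sub>2. sweedler L (\<lambda>a b. F a (\<S> b * scale (\<epsilon> h\<^sub>1) h\<^sub>2)))"
    unfolding int by (subst sweedler_scale) (simp_all add: bF balanced_simps)
  also have "\<dots> = sweedler L (\<lambda>a b. F a (\<S> b * h))"
    by (subst sweedler_counit_left) (simp_all add: bF balanced_simps sweedler_plus)
  finally show ?thesis .
qed

text \<open>
  The augmentation ideal is a left ideal, and a complement of it consists of integrals: multiplication by
  \<open>h - \<epsilon> h\<close> maps the complement, itself a left ideal, into the augmentation ideal.
\<close>

lemma integral_exists:
  assumes "semisimple_ring TYPE('h)"
  obtains L where "\<And>h. h * L = scale (\<epsilon> h) L" "\<epsilon> L = 1"
proof -
  let ?I = "{h. \<epsilon> h = 0}"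
  have e0: "\<epsilon> 0 = 0" using counit_scale[of 0 0] by simp
  have I: "left_ideal ?I" by (simp add: left_ideal_def counit_add counit_mult e0)
  obtain J where J: "left_ideal J" "?I \<inter> J = {0}" and sum: "\<And>h. \<exists>x\<in>?I. \<exists>y\<in>J. h = x + y"
    using assms[unfolded semisimple_ring_def, rule_format, OF I] by auto
  obtain x L where L: "\<epsilon> x = 0" "L \<in> J" "1 = x + L" using sum[of 1] by blast
  have eL: "\<epsilon> L = 1" using L counit_add[of x L] counit_one by simp
  have "h * L = scale (\<epsilon> h) L" for h
  proof -
    have eq: "(h - scale (\<epsilon> h) 1) * L = h * L - scale (\<epsilon> h) L"
      by (simp add: left_diff_distrib scale_mult_left)
    then have "h * L - scale (\<epsilon> h) L \<in> J" using J(1) L(2) by (metis left_ideal_def)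
    moreover have "\<epsilon> (h * L - scale (\<epsilon> h) L) = 0"
      using counit_add[of "h * L - scale (\<epsilon> h) L" "scale (\<epsilon> h) L"]
      by (simp add: counit_mult counit_scale eL)
    ultimately have "h * L - scale (\<epsilon> h) L = 0" using J(2) by blast
    then show ?thesis by simp
  qed
  then show ?thesis using eL that by blast
qed

end

section \<open>Matrices\<close>

lemma sum_lessThan_add:
  "(\<Sum>i<m + n. f i) = (\<Sum>i<m. f i) + (\<Sum>i<n. f (m + i))"
  for f :: "nat \<Rightarrow> 'v::comm_monoid_add"
  by (induction n) (simp_all add: ac_simps)

text \<open>
  The index of a Kronecker product is \<open>i * n + j\<close> for a pair of indices \<open>i\<close> and \<open>j\<close>.
\<close>

lemma sum_lessThan_mult:
  "(\<Sum>p<m * n. f p) = (\<Sum>i<m. \<Sum>j<n. f (i * n + j))"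
  for f :: "nat \<Rightarrow> 'v::comm_monoid_add"
proof (induction m)
  case (Suc m)
  have "(\<Sum>p<Suc m * n. f p) = (\<Sum>p<m * n + n. f p)" by (simp add: add.commute)
  then show ?case by (simp add: sum_lessThan_add Suc)
qed simp

lemma mult_add_less: "i * n + j < m * n" if "i < m" "j < n" for i j m n :: nat
proof -
  have "i * n + j < Suc i * n" using that by simp
  also have "\<dots> \<le> m * n" using that by (intro mult_le_mono1) simp
  finally show ?thesis .
qed

lemma less_mult_split:
  assumes "p < m * (n::nat)"
  obtains i j where "i < m" "j < n" "p = i * n + j"
proof -
  have n: "n > 0" using assms by (cases n) auto
  show ?thesis
  proof (rule that[of "p div n" "p mod n"])
    show "p div n < m" using assms by (simp add: less_mult_imp_div_less)
  qed (use n in auto)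
qed

lemma sum_rotate:
  fixes x :: "'a \<Rightarrow> 'k::comm_semiring_0"
  shows "(\<Sum>i\<in>A. x i * (\<Sum>j\<in>B. \<Sum>l\<in>C. c j l * s i j l)) = (\<Sum>j\<in>B. \<Sum>l\<in>C. c j l * (\<Sum>i\<in>A. x i * s i j l))"
proof -
  have "(\<Sum>i\<in>A. x i * (\<Sum>j\<in>B. \<Sum>l\<in>C. c j l * s i j l)) = (\<Sum>i\<in>A. \<Sum>j\<in>B. \<Sum>l\<in>C. c j l * (x i * s i j l))"
    by (simp add: sum_distrib_left ac_simps)
  also have "\<dots> = (\<Sum>j\<in>B. \<Sum>i\<in>A. \<Sum>l\<in>C. c j l * (x i * s i j l))" by (rule sum.swap)
  also have "\<dots> = (\<Sum>j\<in>B. \<Sum>l\<in>C. \<Sum>i\<in>A. c j l * (x i * s i j l))"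
    by (rule sum.cong[OF refl], rule sum.swap)
  finally show ?thesis by (simp add: sum_distrib_left)
qed

lemma index_mult_mat_sum:
  assumes "A \<in> carrier_mat m l" "B \<in> carrier_mat l n" "i < m" "j < n"
  shows "(A * B) $$ (i, j) = (\<Sum>k<l. A $$ (i, k) * B $$ (k, j))"
  using assms by (simp add: scalar_prod_def atLeast0LessThan)

lemma index_mult_mat_vec_sum:
  assumes "A \<in> carrier_mat m n" "v \<in> carrier_vec n" "i < m"
  shows "(A *\<^sub>v v) $ i = (\<Sum>k<n. A $$ (i, k) * v $ k)"
  using assms by (simp add: scalar_prod_def atLeast0LessThan)

definition mat_trace :: "'a::comm_monoid_add mat \<Rightarrow> 'a" where
  "mat_trace A = (\<Sum>i<dim_row A. A $$ (i, i))"

lemma mat_trace_comm: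
  fixes A B :: "'a::comm_ring_1 mat"
  assumes "A \<in> carrier_mat m n" "B \<in> carrier_mat n m"
  shows "mat_trace (A * B) = mat_trace (B * A)"
proof -
  have "mat_trace (A * B) = (\<Sum>i<m. \<Sum>k<n. A $$ (i, k) * B $$ (k, i))"
    using assms by (simp add: mat_trace_def index_mult_mat_sum del: index_mult_mat)
      (simp add: index_mult_mat_sum[OF assms] del: index_mult_mat(1))
  also have "\<dots> = (\<Sum>k<n. \<Sum>i<m. B $$ (k, i) * A $$ (i, k))"
    by (subst sum.swap) (simp add: mult.commute)
  also have "\<dots> = mat_trace (B * A)"
    using assms by (simp add: mat_trace_def index_mult_mat_sum del: index_mult_mat)
      (simp add: index_mult_mat_sum[OF assms(2,1)] del: index_mult_mat(1))
  finally show ?thesis .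
qed

lemma injective_mat_inverse:
  fixes A :: "'a::field mat"
  assumes A: "A \<in> carrier_mat n n"
    and inj: "\<And>v. v \<in> carrier_vec n \<Longrightarrow> A *\<^sub>v v = 0\<^sub>v n \<Longrightarrow> v = 0\<^sub>v n"
  obtains B where "B \<in> carrier_mat n n" "A * B = 1\<^sub>m n" "B * A = 1\<^sub>m n"
proof -
  have "det A \<noteq> 0" using det_0_iff_vec_prod_zero_field[OF A] inj by blast
  then show ?thesis
    using det_non_zero_imp_unit[OF A, of undefined] that
    by (auto simp: Units_def ring_mat_def)
qed

text \<open>
  Steinitz exchange: among the invertible matrices whose first \<open>r\<close> columns lie in \<open>W\<close>, one with the
  greatest \<open>r\<close> has enough columns in \<open>W\<close> to span it.
\<close>

lemma adapted_basis:
  fixes W :: "'a::field vec set"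
  assumes W: "W \<subseteq> carrier_vec d"
  obtains r Q Q' where "r \<le> d" "Q \<in> carrier_mat d d" "Q' \<in> carrier_mat d d"
    "Q * Q' = 1\<^sub>m d" "Q' * Q = 1\<^sub>m d" "\<And>j. j < r \<Longrightarrow> col Q j \<in> W"
    "\<And>w i. w \<in> W \<Longrightarrow> r \<le> i \<Longrightarrow> i < d \<Longrightarrow> (Q' *\<^sub>v w) $ i = 0"
proof -
  define good where "good r Q Q' \<longleftrightarrow> r \<le> d \<and> Q \<in> carrier_mat d d \<and> Q' \<in> carrier_mat d d \<and>
    Q * Q' = 1\<^sub>m d \<and> Q' * Q = 1\<^sub>m d \<and> (\<forall>j<r. col Q j \<in> W)" for r and Q Q' :: "'a mat"
  let ?R = "{r. \<exists>Q Q'. good r Q Q'}"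
  define r where "r = Max ?R"
  have fin: "finite ?R" by (rule finite_subset[of _ "{..d}"]) (auto simp: good_def)
  have "good 0 (1\<^sub>m d) (1\<^sub>m d)" by (simp add: good_def)
  then have "r \<in> ?R" unfolding r_def using fin by (intro Max_in) auto
  then obtain Q Q' where g: "good r Q Q'" by blast
  note gd = g[unfolded good_def]
  have "(Q' *\<^sub>v w) $ i = 0" if w: "w \<in> W" and i: "r \<le> i" "i < d" for w i
  proof (rule ccontr)
    assume nz: "(Q' *\<^sub>v w) $ i \<noteq> 0"
    define c where "c = Q' *\<^sub>v w"
    have wd: "w \<in> carrier_vec d" using w W by blast
    then have c: "c \<in> carrier_vec d" using gd by (simp add: c_def mult_mat_vec_carrier[of _ d d])
    have r: "r < d" using i by simp
    \<comment> \<open>\<open>Q * E\<close> is \<open>Q\<close> with column \<open>r\<close> moved to place \<open>i\<close> and \<open>w\<close> put in its stead.\<close>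
    define E where "E = mat d d (\<lambda>(p, q). if q = r then c $ p
      else if q = i then (if p = r then 1 else 0) else (if p = q then 1 else 0))"
    have E: "E \<in> carrier_mat d d" by (simp add: E_def)
    have inj: "v = 0\<^sub>v d" if v: "v \<in> carrier_vec d" and Ev: "E *\<^sub>v v = 0\<^sub>v d" for v
    proof -
      have row: "(\<Sum>q<d. E $$ (p, q) * v $ q) = 0" if "p < d" for p
        using index_mult_mat_vec_sum[OF E v that] Ev that by simp
      have "(\<Sum>q<d. E $$ (i, q) * v $ q) = (\<Sum>q<d. if q = r then c $ i * v $ r else 0)"
        by (rule sum.cong) (use i in \<open>auto simp: E_def\<close>)
      then have vr: "v $ r = 0" using row[OF i(2)] r nz by (simp add: c_def)
      have "(\<Sum>q<d. E $$ (r, q) * v $ q) = (\<Sum>q<d. if q = i then v $ i else 0)"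
        by (rule sum.cong) (use i r vr in \<open>auto simp: E_def\<close>)
      then have vi: "v $ i = 0" using row[OF r] i by simp
      have "v $ p = 0" if p: "p < d" for p
      proof (cases "p = r \<or> p = i")
        case False
        then have "(\<Sum>q<d. E $$ (p, q) * v $ q) = (\<Sum>q<d. if q = p then v $ p else 0)"
          by (intro sum.cong) (use p vr in \<open>auto simp: E_def\<close>)
        then show ?thesis using row[OF p] p by simp
      qed (use vr vi in auto)
      then show ?thesis using v by (intro eq_vecI) auto
    qed
    have Qc: "Q *\<^sub>v c = w"
      using gd wd by (simp add: c_def flip: assoc_mult_mat_vec[of Q d d Q' d])
    have "Q * E \<in> carrier_mat d d" using gd E by (auto intro: mult_carrier_mat)
    moreover have "v = 0\<^sub>v d" if v: "v \<in> carrier_vec d" and QEv: "Q * E *\<^sub>v v = 0\<^sub>v d" for v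
    proof -
      have "E *\<^sub>v v = Q' *\<^sub>v (Q *\<^sub>v (E *\<^sub>v v))"
        using gd E v by (simp flip: assoc_mult_mat_vec[of Q' d d Q d])
      also have "\<dots> = Q' *\<^sub>v (Q * E *\<^sub>v v)"
        using gd E v by (simp add: assoc_mult_mat_vec[of Q d d E d])
      also have "\<dots> = 0\<^sub>v d" using gd by (auto simp: QEv)
      finally show ?thesis by (rule inj[OF v])
    qed
    ultimately obtain B where B: "B \<in> carrier_mat d d" "Q * E * B = 1\<^sub>m d" "B * (Q * E) = 1\<^sub>m d"
      using injective_mat_inverse by blast
    have "col (Q * E) j \<in> W" if j: "j < Suc r" for j
    proof (cases "j = r")
      case True
      have "col E r = c" using r c by (auto simp: E_def)
      then show ?thesis using True r gd E Qc w by (simp add: col_mult2[of _ d d _ d])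
    next
      case False
      then have E1: "col E j = col (1\<^sub>m d) j" using j r i by (intro eq_vecI) (auto simp: E_def)
      have Qd: "Q \<in> carrier_mat d d" and jd: "j < d" using gd j r by auto
      have "col (Q * E) j = col (Q * 1\<^sub>m d) j"
        unfolding col_mult2[OF Qd E jd] col_mult2[OF Qd one_carrier_mat jd] E1 ..
      then have "col (Q * E) j = col Q j" using Qd by simp
      then show ?thesis using False j gd by simp
    qed
    then have "Suc r \<in> ?R" using B r \<open>Q * E \<in> carrier_mat d d\<close> unfolding good_def by auto
    then have "Suc r \<le> r" unfolding r_def using fin by (intro Max_ge) auto
    then show False by simp
  qed
  then show ?thesis using that[of r Q Q'] gd by blast
qed

text \<open>
  The hypotheses \<open>A B = B\<close> and \<open>B A = A\<close> say that \<open>A\<close> and \<open>B\<close> are idempotent with the same image.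
  The trace of \<open>A = B A\<close> is that of \<open>A B = B\<close>.
\<close>

lemma idempotent_trace_eq:
  fixes A B :: "'i \<Rightarrow> 'i \<Rightarrow> 'a::comm_ring_1"
  assumes "\<And>x z. x \<in> I \<Longrightarrow> z \<in> I \<Longrightarrow> (\<Sum>y\<in>I. A x y * B y z) = B x z"
    and "\<And>x z. x \<in> I \<Longrightarrow> z \<in> I \<Longrightarrow> (\<Sum>y\<in>I. B x y * A y z) = A x z"
  shows "(\<Sum>x\<in>I. A x x) = (\<Sum>x\<in>I. B x x)"
proof -
  have "(\<Sum>x\<in>I. A x x) = (\<Sum>x\<in>I. \<Sum>y\<in>I. B x y * A y x)" by (simp add: assms(2))
  also have "\<dots> = (\<Sum>y\<in>I. \<Sum>x\<in>I. A y x * B x y)"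
    by (subst sum.swap) (simp add: mult.commute)
  also have "\<dots> = (\<Sum>x\<in>I. B x x)" by (simp add: assms(1))
  finally show ?thesis .
qed

section \<open>Modules, isomorphism and direct sums\<close>

lemma rep_isoI:
  assumes "rdim \<rho> = d" "rdim \<sigma> = d" "P \<in> carrier_mat d d" "Q \<in> carrier_mat d d"
    "P * Q = 1\<^sub>m d" "Q * P = 1\<^sub>m d" "\<And>h. P * \<rho> h = \<sigma> h * P"
  shows "rep_iso \<rho> \<sigma>"
  using assms unfolding rep_iso_def invertible_mat_def inverts_mat_def
  by (intro conjI bexI[of _ P] exI[of _ Q]) auto

lemma rep_isoE:
  assumes "rep_iso \<rho> \<sigma>"
  obtains P Q where "rdim \<sigma> = rdim \<rho>" "P \<in> carrier_mat (rdim \<rho>) (rdim \<rho>)"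
    "Q \<in> carrier_mat (rdim \<rho>) (rdim \<rho>)" "P * Q = 1\<^sub>m (rdim \<rho>)" "Q * P = 1\<^sub>m (rdim \<rho>)"
    "\<And>h. P * \<rho> h = \<sigma> h * P"
proof -
  obtain P Q where P: "P \<in> carrier_mat (rdim \<rho>) (rdim \<rho>)" "P * Q = 1\<^sub>m (dim_row P)"
      "Q * P = 1\<^sub>m (dim_row Q)" "rdim \<sigma> = rdim \<rho>" "\<And>h. P * \<rho> h = \<sigma> h * P"
    using assms unfolding rep_iso_def invertible_mat_def inverts_mat_def by auto
  have "dim_col (P * Q) = dim_row P" "dim_col (Q * P) = dim_row Q" by (simp_all add: P(2,3))
  then have "Q \<in> carrier_mat (rdim \<rho>) (rdim \<rho>)" using P(1) by auto
  then show ?thesis using P that by auto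
qed

lemma rep_iso_refl:
  assumes "\<And>h. \<rho> h \<in> carrier_mat (rdim \<rho>) (rdim \<rho>)"
  shows "rep_iso \<rho> \<rho>"
proof (rule rep_isoI[of _ "rdim \<rho>" _ "1\<^sub>m (rdim \<rho>)" "1\<^sub>m (rdim \<rho>)"])
  show "1\<^sub>m (rdim \<rho>) * \<rho> h = \<rho> h * 1\<^sub>m (rdim \<rho>)" for h using assms[of h] by simp
qed simp_all

lemma rep_iso_sym:
  assumes "rep_iso \<rho> \<sigma>"
    and \<rho>: "\<And>h. \<rho> h \<in> carrier_mat (rdim \<rho>) (rdim \<rho>)"
    and \<sigma>: "\<And>h. \<sigma> h \<in> carrier_mat (rdim \<sigma>) (rdim \<sigma>)"
  shows "rep_iso \<sigma> \<rho>"
  using assms(1)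
proof (rule rep_isoE)
  fix P Q assume *: "rdim \<sigma> = rdim \<rho>" "P \<in> carrier_mat (rdim \<rho>) (rdim \<rho>)"
    "Q \<in> carrier_mat (rdim \<rho>) (rdim \<rho>)" "P * Q = 1\<^sub>m (rdim \<rho>)" "Q * P = 1\<^sub>m (rdim \<rho>)"
    "\<And>h. P * \<rho> h = \<sigma> h * P"
  show ?thesis
  proof (rule rep_isoI[of _ "rdim \<rho>" _ Q P])
    fix h
    let ?d = "rdim \<rho>"
    have \<sigma>h: "\<sigma> h \<in> carrier_mat ?d ?d" using \<sigma>[of h] * by simp
    have "Q * \<sigma> h = Q * (\<sigma> h * (P * Q))" using * \<sigma>h by simp
    also have "\<dots> = Q * (\<sigma> h * P * Q)" using * \<sigma>h by (simp add: assoc_mult_mat[of _ ?d ?d _ ?d _ ?d])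
    also have "\<dots> = Q * (P * \<rho> h * Q)" using * by simp
    also have "\<dots> = (Q * P) * (\<rho> h * Q)"
      using *(1-3) \<rho>[of h] by (simp add: assoc_mult_mat[of _ ?d ?d _ ?d _ ?d])
    also have "\<dots> = \<rho> h * Q" using * \<rho>[of h] by simp
    finally show "Q * \<sigma> h = \<rho> h * Q" .
  qed (use * in auto)
qed

lemma rep_iso_trans:
  assumes "rep_iso \<rho> \<sigma>" "rep_iso \<sigma> \<tau>"
    and \<rho>: "\<And>h. \<rho> h \<in> carrier_mat (rdim \<rho>) (rdim \<rho>)"
    and \<sigma>: "\<And>h. \<sigma> h \<in> carrier_mat (rdim \<sigma>) (rdim \<sigma>)"
    and \<tau>: "\<And>h. \<tau> h \<in> carrier_mat (rdim \<tau>) (rdim \<tau>)"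
  shows "rep_iso \<rho> \<tau>"
proof -
  obtain P Q where P: "rdim \<sigma> = rdim \<rho>" "P \<in> carrier_mat (rdim \<rho>) (rdim \<rho>)"
    "Q \<in> carrier_mat (rdim \<rho>) (rdim \<rho>)" "P * Q = 1\<^sub>m (rdim \<rho>)" "Q * P = 1\<^sub>m (rdim \<rho>)"
    "\<And>h. P * \<rho> h = \<sigma> h * P" using rep_isoE[OF assms(1)] by metis
  obtain P' Q' where P': "rdim \<tau> = rdim \<sigma>" "P' \<in> carrier_mat (rdim \<sigma>) (rdim \<sigma>)"
    "Q' \<in> carrier_mat (rdim \<sigma>) (rdim \<sigma>)" "P' * Q' = 1\<^sub>m (rdim \<sigma>)" "Q' * P' = 1\<^sub>m (rdim \<sigma>)"
    "\<And>h. P' * \<sigma> h = \<tau> h * P'" using rep_isoE[OF assms(2)] by metis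
  let ?d = "rdim \<rho>"
  note assoc = assoc_mult_mat[of _ ?d ?d _ ?d _ ?d]
  note P'd = P'[unfolded P(1)]
  show ?thesis
  proof (rule rep_isoI[of _ ?d _ "P' * P" "Q * Q'"])
    have "P' * P * (Q * Q') = P' * (P * Q) * Q'"
      using P(2,3) P'd(2,3) by (simp add: assoc del: P(4))
    then show "P' * P * (Q * Q') = 1\<^sub>m ?d" using P P'd by simp
    have "Q * Q' * (P' * P) = Q * (Q' * P') * P"
      using P(2,3) P'd(2,3) by (simp add: assoc)
    then show "Q * Q' * (P' * P) = 1\<^sub>m ?d" using P P'd by simp
    fix h
    have h: "\<rho> h \<in> carrier_mat ?d ?d" "\<sigma> h \<in> carrier_mat ?d ?d" "\<tau> h \<in> carrier_mat ?d ?d"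
      using \<rho>[of h] \<sigma>[of h] \<tau>[of h] P(1) P'(1) by simp_all
    have "P' * P * \<rho> h = P' * (P * \<rho> h)" using P(2,3) P'd(2,3) h by (simp add: assoc)
    also have "\<dots> = P' * \<sigma> h * P" using P(2,3) P'd(2,3) h by (simp add: assoc P(6))
    also have "\<dots> = \<tau> h * (P' * P)" using P(2,3) P'd(2,3) h by (simp add: assoc P'(6))
    finally show "P' * P * \<rho> h = \<tau> h * (P' * P)" .
  qed (use P P'd in auto)
qed

lemma rep_iso_trace:
  assumes "rep_iso \<rho> \<sigma>"
    and \<rho>: "\<And>h. \<rho> h \<in> carrier_mat (rdim \<rho>) (rdim \<rho>)"
    and \<sigma>: "\<And>h. \<sigma> h \<in> carrier_mat (rdim \<sigma>) (rdim \<sigma>)"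
  shows "mat_trace (\<rho> h) = mat_trace (\<sigma> h)"
proof -
  let ?d = "rdim \<rho>"
  obtain P Q where P: "rdim \<sigma> = ?d" "P \<in> carrier_mat ?d ?d"
    "Q \<in> carrier_mat ?d ?d" "P * Q = 1\<^sub>m ?d" "Q * P = 1\<^sub>m ?d"
    "\<And>h. P * \<rho> h = \<sigma> h * P" using rep_isoE[OF assms(1)] by metis
  have \<sigma>h: "\<sigma> h \<in> carrier_mat ?d ?d" using \<sigma>[of h] P(1) by simp
  have "\<rho> h = Q * P * \<rho> h" using P \<rho>[of h] by simp
  also have "\<dots> = Q * (\<sigma> h * P)"
    using P(2,3) \<rho>[of h] by (simp add: assoc_mult_mat[of _ ?d ?d _ ?d _ ?d] P(6))
  finally have "mat_trace (\<rho> h) = mat_trace (\<sigma> h * P * Q)"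
    using mat_trace_comm[of Q ?d ?d "\<sigma> h * P"] P(2,3) \<sigma>h by simp
  also have "\<sigma> h * P * Q = \<sigma> h * (P * Q)"
    by (rule assoc_mult_mat[OF \<sigma>h P(2,3)])
  also have "\<dots> = \<sigma> h" using P(4) \<sigma>h by simp
  finally show ?thesis .
qed

context algebra_over
begin

lemma module_carrier: "is_module \<rho> \<Longrightarrow> \<rho> h \<in> carrier_mat (rdim \<rho>) (rdim \<rho>)"
  by (simp add: is_module_def)

lemma module_dim [simp]:
  "is_module \<rho> \<Longrightarrow> dim_row (\<rho> h) = rdim \<rho>" "is_module \<rho> \<Longrightarrow> dim_col (\<rho> h) = rdim \<rho>"
  using module_carrier by blast+

lemma module_entry:
  assumes "is_module \<rho>" "i < rdim \<rho>" "j < rdim \<rho>"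
  shows module_add: "\<rho> (x + y) $$ (i, j) = \<rho> x $$ (i, j) + \<rho> y $$ (i, j)"
    and module_scale: "\<rho> (scale c x) $$ (i, j) = c * \<rho> x $$ (i, j)"
    and module_mult: "\<rho> (x * y) $$ (i, j) = (\<Sum>k<rdim \<rho>. \<rho> x $$ (i, k) * \<rho> y $$ (k, j))"
    and module_one: "\<rho> 1 $$ (i, j) = (if i = j then 1 else 0)"
proof -
  note c = module_carrier[OF assms(1)]
  show "\<rho> (x + y) $$ (i, j) = \<rho> x $$ (i, j) + \<rho> y $$ (i, j)"
    "\<rho> (scale c x) $$ (i, j) = c * \<rho> x $$ (i, j)" "\<rho> 1 $$ (i, j) = (if i = j then 1 else 0)"
    using assms carrier_matD[OF c] by (simp_all add: is_module_def)
  have "\<rho> (x * y) = \<rho> x * \<rho> y" using assms(1) unfolding is_module_def by blast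
  then show "\<rho> (x * y) $$ (i, j) = (\<Sum>k<rdim \<rho>. \<rho> x $$ (i, k) * \<rho> y $$ (k, j))"
    using index_mult_mat_sum[OF c c assms(2,3)] by simp
qed

text \<open>
  The actions on tensor products, duals and the regular module are given entry by entry, and sums over
  the coproduct live in the field; hence this entrywise form of the module axioms.
\<close>

lemma is_moduleI:
  assumes c: "\<And>h. \<rho> h \<in> carrier_mat d d"
    and "\<And>x y i j. i < d \<Longrightarrow> j < d \<Longrightarrow> \<rho> (x + y) $$ (i, j) = \<rho> x $$ (i, j) + \<rho> y $$ (i, j)"
    and "\<And>c x i j. i < d \<Longrightarrow> j < d \<Longrightarrow> \<rho> (scale c x) $$ (i, j) = c * \<rho> x $$ (i, j)"
    and m: "\<And>x y i j. i < d \<Longrightarrow> j < d \<Longrightarrow>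
      \<rho> (x * y) $$ (i, j) = (\<Sum>k<d. \<rho> x $$ (i, k) * \<rho> y $$ (k, j))"
    and "\<And>i j. i < d \<Longrightarrow> j < d \<Longrightarrow> \<rho> 1 $$ (i, j) = (if i = j then 1 else 0)"
  shows "is_module \<rho>"
proof -
  have d: "rdim \<rho> = d" using c[of 1] by (simp add: rdim_def)
  have dims [simp]: "dim_row (\<rho> h) = d" "dim_col (\<rho> h) = d" for h using c[of h] by auto
  show ?thesis
    unfolding is_module_def d
    by (intro conjI allI c; rule eq_matI)
      (simp_all add: assms(2,3,5) m index_mult_mat_sum[OF c c] del: index_mult_mat(1))
qed

lemma module_sum_entry:
  assumes \<rho>: "is_module \<rho>" and i: "i < rdim \<rho>" and j: "j < rdim \<rho>"
  shows "\<rho> (\<Sum>k\<in>K. x k) $$ (i, j) = (\<Sum>k\<in>K. \<rho> (x k) $$ (i, j))"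
proof -
  have "\<rho> 0 $$ (i, j) = 0" using module_scale[OF assms, of 0 0] by simp
  then show ?thesis
    by (induction K rule: infinite_finite_induct) (simp_all add: module_add[OF assms])
qed

lemma module_iso_refl: "is_module \<rho> \<Longrightarrow> rep_iso \<rho> \<rho>"
  by (rule rep_iso_refl) (rule module_carrier)

lemma module_iso_sym: "is_module \<rho> \<Longrightarrow> is_module \<sigma> \<Longrightarrow> rep_iso \<rho> \<sigma> \<Longrightarrow> rep_iso \<sigma> \<rho>"
  by (rule rep_iso_sym) (simp_all add: module_carrier)

lemma module_iso_trans:
  "is_module \<rho> \<Longrightarrow> is_module \<sigma> \<Longrightarrow> is_module \<tau> \<Longrightarrow> rep_iso \<rho> \<sigma> \<Longrightarrow> rep_iso \<sigma> \<tau> \<Longrightarrow> rep_iso \<rho> \<tau>"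
  by (rule rep_iso_trans[of \<rho> \<sigma> \<tau>]) (simp_all add: module_carrier)

lemma module_iso_trace:
  "is_module \<rho> \<Longrightarrow> is_module \<sigma> \<Longrightarrow> rep_iso \<rho> \<sigma> \<Longrightarrow> mat_trace (\<rho> h) = mat_trace (\<sigma> h)"
  by (rule rep_iso_trace) (simp_all add: module_carrier)

text \<open>
  The representative of a class is chosen so that it is itself simple of dimension \<open>d\<close>, which spares
  transporting simplicity along isomorphisms.
\<close>

lemma class_representatives:
  assumes "finite (simple_classes d)"
  obtains R where "finite R" "\<And>V. V \<in> R \<Longrightarrow> simple_module V \<and> rdim V = d"
    "\<And>V W. V \<in> R \<Longrightarrow> W \<in> R \<Longrightarrow> rep_iso V W \<Longrightarrow> V = W"
    "\<And>V. simple_module V \<Longrightarrow> rdim V = d \<Longrightarrow> \<exists>W\<in>R. rep_iso V W"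
proof -
  define E where "E = {(\<rho>, \<sigma>). is_module \<rho> \<and> is_module \<sigma> \<and> rep_iso \<rho> \<sigma>}"
  have sm: "is_module V" if "simple_module V" for V using that by (simp add: simple_module_def)
  have classes: "simple_classes d = (\<lambda>\<rho>. E `` {\<rho>}) ` {\<rho>. simple_module \<rho> \<and> rdim \<rho> = d}"
    unfolding simple_classes_def quotient_def E_def by blast
  then have "\<forall>C\<in>simple_classes d. \<exists>\<rho>. simple_module \<rho> \<and> rdim \<rho> = d \<and> C = E `` {\<rho>}" by blast
  then obtain f where f: "\<And>C. C \<in> simple_classes d \<Longrightarrow>
      simple_module (f C) \<and> rdim (f C) = d \<and> C = E `` {f C}" by metis
  show ?thesis
  proof (rule that[of "f ` simple_classes d"])
    show "finite (f ` simple_classes d)" using assms by simp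
    show "simple_module V \<and> rdim V = d" if "V \<in> f ` simple_classes d" for V using that f by blast
    show "V = W" if VW: "V \<in> f ` simple_classes d" "W \<in> f ` simple_classes d" "rep_iso V W" for V W
    proof -
      obtain C D where CD: "C \<in> simple_classes d" "D \<in> simple_classes d" "V = f C" "W = f D"
        using VW by blast
      have m: "is_module V" "is_module W" using CD f sm by auto
      have "rep_iso V X \<longleftrightarrow> rep_iso W X" if "is_module X" for X
        using module_iso_trans[OF m(1,2) that VW(3)]
          module_iso_trans[OF m(2,1) that module_iso_sym[OF m VW(3)]] by blast
      then have "E `` {V} = E `` {W}" using m by (auto simp: E_def)
      then have "C = D" using f CD by metis
      then show ?thesis using CD by simp
    qed
    show "\<exists>W\<in>f ` simple_classes d. rep_iso V W" if V: "simple_module V" "rdim V = d" for V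
    proof -
      have C: "E `` {V} \<in> simple_classes d" unfolding classes using V by blast
      have "V \<in> E `` {V}" using sm[OF V(1)] module_iso_refl by (simp add: E_def)
      then have "V \<in> E `` {f (E `` {V})}" using f[OF C] by simp
      then have "rep_iso V (f (E `` {V}))" using module_iso_sym by (auto simp: E_def)
      then show ?thesis using C by blast
    qed
  qed
qed

lemma rep_sum_entry:
  assumes "is_module \<rho>" "is_module \<sigma>" "i < rdim \<rho> + rdim \<sigma>" "j < rdim \<rho> + rdim \<sigma>"
  shows "rep_sum \<rho> \<sigma> h $$ (i, j) = 
    (if i < rdim \<rho> then if j < rdim \<rho> then \<rho> h $$ (i, j) else 0
     else if j < rdim \<rho> then 0 else \<sigma> h $$ (i - rdim \<rho>, j - rdim \<rho>))"
  using assms by (auto simp: rep_sum_def)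

lemma rep_sum_carrier:
  "is_module \<rho> \<Longrightarrow> is_module \<sigma> \<Longrightarrow>
    rep_sum \<rho> \<sigma> h \<in> carrier_mat (rdim \<rho> + rdim \<sigma>) (rdim \<rho> + rdim \<sigma>)"
  by (auto simp: rep_sum_def)

lemma rdim_rep_sum: "is_module \<rho> \<Longrightarrow> is_module \<sigma> \<Longrightarrow> rdim (rep_sum \<rho> \<sigma>) = rdim \<rho> + rdim \<sigma>"
  unfolding rdim_def[of "rep_sum \<rho> \<sigma>"] by (rule carrier_matD(1)[OF rep_sum_carrier])

lemma trace_rep_sum:
  assumes "is_module \<rho>" "is_module \<sigma>"
  shows "mat_trace (rep_sum \<rho> \<sigma> h) = mat_trace (\<rho> h) + mat_trace (\<sigma> h)"
  using rep_sum_carrier[OF assms, of h] assms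
  by (simp add: mat_trace_def rep_sum_entry sum_lessThan_add)

lemma is_module_rep_sum:
  assumes \<rho>: "is_module \<rho>" and \<sigma>: "is_module \<sigma>"
  shows "is_module (rep_sum \<rho> \<sigma>)"
proof (rule is_moduleI[OF rep_sum_carrier[OF assms]])
  fix x y i j assume ij: "i < rdim \<rho> + rdim \<sigma>" "j < rdim \<rho> + rdim \<sigma>"
  note e = rep_sum_entry[OF assms]
  show "rep_sum \<rho> \<sigma> (x + y) $$ (i, j) = rep_sum \<rho> \<sigma> x $$ (i, j) + rep_sum \<rho> \<sigma> y $$ (i, j)"
    using ij by (auto simp: e module_add[OF \<rho>] module_add[OF \<sigma>])
  show "rep_sum \<rho> \<sigma> (x * y) $$ (i, j) =
      (\<Sum>k<rdim \<rho> + rdim \<sigma>. rep_sum \<rho> \<sigma> x $$ (i, k) * rep_sum \<rho> \<sigma> y $$ (k, j))"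
    using ij by (auto simp: e sum_lessThan_add module_mult[OF \<rho>] module_mult[OF \<sigma>])
  show "rep_sum \<rho> \<sigma> 1 $$ (i, j) = (if i = j then 1 else 0)"
    using ij by (auto simp: e module_one[OF \<rho>] module_one[OF \<sigma>])
next
  fix c x i j assume ij: "i < rdim \<rho> + rdim \<sigma>" "j < rdim \<rho> + rdim \<sigma>"
  note e = rep_sum_entry[OF assms]
  show "rep_sum \<rho> \<sigma> (scale c x) $$ (i, j) = c * rep_sum \<rho> \<sigma> x $$ (i, j)"
    using ij by (auto simp: e module_scale[OF \<rho>] module_scale[OF \<sigma>])
qed

lemma is_module_conjugate:
  assumes \<rho>: "is_module \<rho>" and Q: "Q \<in> carrier_mat (rdim \<rho>) (rdim \<rho>)"
    and Q': "Q' \<in> carrier_mat (rdim \<rho>) (rdim \<rho>)"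
    and inv: "Q * Q' = 1\<^sub>m (rdim \<rho>)" "Q' * Q = 1\<^sub>m (rdim \<rho>)"
  shows "is_module (\<lambda>h. Q' * \<rho> h * Q)" and "rep_iso \<rho> (\<lambda>h. Q' * \<rho> h * Q)"
proof -
  let ?d = "rdim \<rho>" and ?\<rho> = "\<lambda>h. Q' * \<rho> h * Q"
  note c = module_carrier[OF \<rho>]
  have Qc: "Q' * \<rho> h \<in> carrier_mat ?d ?d" for h by (rule mult_carrier_mat[OF Q' c])
  have c': "?\<rho> h \<in> carrier_mat ?d ?d" for h by (rule mult_carrier_mat[OF Qc Q])
  note assoc = assoc_mult_mat[of _ ?d ?d _ ?d _ ?d]
  have d: "rdim ?\<rho> = ?d" unfolding rdim_def[of ?\<rho>] by (rule carrier_matD(1)[OF c'])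
  have "?\<rho> (x + y) = ?\<rho> x + ?\<rho> y" for x y
  proof -
    have "\<rho> (x + y) = \<rho> x + \<rho> y" using \<rho> by (simp add: is_module_def)
    then show ?thesis
      by (simp add: mult_add_distrib_mat[OF Q' c c] add_mult_distrib_mat[OF Qc Qc Q])
  qed
  moreover have "?\<rho> (scale k x) = k \<cdot>\<^sub>m ?\<rho> x" for k x
  proof -
    have "\<rho> (scale k x) = k \<cdot>\<^sub>m \<rho> x" using \<rho> by (simp add: is_module_def)
    then show ?thesis
      by (simp add: mult_smult_distrib[OF Q' c] mult_smult_assoc_mat[OF Qc Q])
  qed
  moreover have "?\<rho> (x * y) = ?\<rho> x * ?\<rho> y" for x y
  proof -
    have "\<rho> (x * y) = \<rho> x * \<rho> y" using \<rho> by (simp add: is_module_def)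
    also have "\<dots> = \<rho> x * (Q * Q' * \<rho> y)" using left_mult_one_mat[OF c] by (simp add: inv)
    also have "Q' * \<dots> * Q = ?\<rho> x * ?\<rho> y"
      using Q Q' c[of x] c[of y] by (simp add: assoc del: inv)
    finally show ?thesis .
  qed
  moreover have "?\<rho> 1 = 1\<^sub>m ?d"
  proof -
    have "\<rho> 1 = 1\<^sub>m ?d" using \<rho> unfolding is_module_def by blast
    then show ?thesis using Q Q' inv by simp
  qed
  ultimately show "is_module ?\<rho>" unfolding is_module_def d using c' by blast
  show "rep_iso \<rho> ?\<rho>"
  proof (rule rep_isoI[OF refl d Q' Q inv(2,1)])
    fix h
    have "?\<rho> h * Q' = Q' * \<rho> h * (Q * Q')" by (rule assoc_mult_mat[OF Qc Q Q'])
    then show "Q' * \<rho> h = ?\<rho> h * Q'" using right_mult_one_mat[OF Qc, of h] by (simp add: inv)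
  qed
qed

text \<open>
  \<open>P\<close> stands for the matrix with entries \<open>P p q\<close>, which intertwines \<open>\<rho>\<close> and \<open>\<sigma>\<close>.  A function can be an
  arbitrary slice of the averaging kernel or be reindexed, without a passage through matrices.
\<close>

definition hom_entries :: "('h, 'k) rep \<Rightarrow> ('h, 'k) rep \<Rightarrow> (nat \<Rightarrow> nat \<Rightarrow> 'k) \<Rightarrow> bool" where
  "hom_entries \<rho> \<sigma> P \<longleftrightarrow> (\<forall>h. \<forall>p<rdim \<sigma>. \<forall>q<rdim \<rho>.
     (\<Sum>k<rdim \<sigma>. \<sigma> h $$ (p, k) * P k q) = (\<Sum>k<rdim \<rho>. P p k * \<rho> h $$ (k, q)))"

lemma hom_entries_sum:
  assumes "\<And>i. i \<in> I \<Longrightarrow> hom_entries \<rho> \<sigma> (P i)"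
  shows "hom_entries \<rho> \<sigma> (\<lambda>p q. \<Sum>i\<in>I. P i p q)"
  unfolding hom_entries_def
proof (intro allI impI)
  fix h p q assume "p < rdim \<sigma>" "q < rdim \<rho>"
  then have "(\<Sum>k<rdim \<sigma>. \<sigma> h $$ (p, k) * P i k q) = (\<Sum>k<rdim \<rho>. P i p k * \<rho> h $$ (k, q))"
    if "i \<in> I" for i using assms[OF that] unfolding hom_entries_def by blast
  then have eq: "(\<Sum>i\<in>I. \<Sum>k<rdim \<sigma>. \<sigma> h $$ (p, k) * P i k q) =
      (\<Sum>i\<in>I. \<Sum>k<rdim \<rho>. P i p k * \<rho> h $$ (k, q))" by simp
  have "(\<Sum>k<rdim \<sigma>. \<sigma> h $$ (p, k) * (\<Sum>i\<in>I. P i k q)) =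
      (\<Sum>i\<in>I. \<Sum>k<rdim \<sigma>. \<sigma> h $$ (p, k) * P i k q)"
    unfolding sum_distrib_left by (rule sum.swap)
  also note eq
  also have "(\<Sum>i\<in>I. \<Sum>k<rdim \<rho>. P i p k * \<rho> h $$ (k, q)) =
      (\<Sum>k<rdim \<rho>. (\<Sum>i\<in>I. P i p k) * \<rho> h $$ (k, q))"
    unfolding sum_distrib_right by (rule sum.swap)
  finally show "(\<Sum>k<rdim \<sigma>. \<sigma> h $$ (p, k) * (\<Sum>i\<in>I. P i k q)) =
      (\<Sum>k<rdim \<rho>. (\<Sum>i\<in>I. P i p k) * \<rho> h $$ (k, q))" .
qed

lemma hom_entries_mat:
  assumes \<rho>: "is_module \<rho>" and \<sigma>: "is_module \<sigma>" and "hom_entries \<rho> \<sigma> P"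
  shows "\<sigma> h * mat (rdim \<sigma>) (rdim \<rho>) (\<lambda>(i, j). P i j) = mat (rdim \<sigma>) (rdim \<rho>) (\<lambda>(i, j). P i j) * \<rho> h"
proof (rule eq_matI)
  let ?P = "mat (rdim \<sigma>) (rdim \<rho>) (\<lambda>(i, j). P i j)"
  fix i j assume "i < dim_row (?P * \<rho> h)" "j < dim_col (?P * \<rho> h)"
  then have ij: "i < rdim \<sigma>" "j < rdim \<rho>" using \<rho> by simp_all
  have P: "?P \<in> carrier_mat (rdim \<sigma>) (rdim \<rho>)" by simp
  show "(\<sigma> h * ?P) $$ (i, j) = (?P * \<rho> h) $$ (i, j)"
    unfolding index_mult_mat_sum[OF module_carrier[OF \<sigma>] P ij]
      index_mult_mat_sum[OF P module_carrier[OF \<rho>] ij]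
    using assms(3) ij by (simp add: hom_entries_def)
qed (use assms in simp_all)

definition transversal :: "('h, 'k) rep set \<Rightarrow> bool" where
  "transversal R \<longleftrightarrow> finite R \<and> (\<forall>V\<in>R. simple_module V) \<and>
     (\<forall>V\<in>R. \<forall>W\<in>R. rep_iso V W \<longrightarrow> V = W) \<and> (\<forall>V. simple_module V \<longrightarrow> (\<exists>W\<in>R. rep_iso V W))"

lemma balanced_entries:
  assumes "is_module \<rho>" "is_module \<sigma>" "i < rdim \<rho>" "k < rdim \<rho>" "j < rdim \<sigma>" "l < rdim \<sigma>"
  shows "balanced (\<lambda>a b. \<rho> a $$ (i, k) * \<sigma> b $$ (j, l))"
  using assms by (simp add: balanced_def module_add module_scale algebra_simps)

end

section \<open>Averaging over the integral\<close>

locale semisimple_hopf_algebra = fin_dim_hopf_algebra scale \<Delta> \<epsilon> \<S>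
  for scale :: "'k::{alg_closed_field, field_char_0} \<Rightarrow> 'h::ring_1 \<Rightarrow> 'h" and \<Delta> \<epsilon> \<S> +
  assumes semisimple: "semisimple_ring TYPE('h)"

context semisimple_hopf_algebra
begin

definition integral :: 'h where
  "integral = (SOME L. (\<forall>h. h * L = scale (\<epsilon> h) L) \<and> \<epsilon> L = 1)"

lemma integral: "h * integral = scale (\<epsilon> h) integral" "\<epsilon> integral = 1"
proof -
  obtain L where "\<And>h. h * L = scale (\<epsilon> h) L" "\<epsilon> L = 1"
    using integral_exists[OF semisimple] by blast
  then have "\<exists>L. (\<forall>h. h * L = scale (\<epsilon> h) L) \<and> \<epsilon> L = 1" by blast
  from someI_ex[OF this] show "h * integral = scale (\<epsilon> h) integral" "\<epsilon> integral = 1"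
    unfolding integral_def by blast+
qed

text \<open>
  The entry at \<open>(p, q)\<close> of the average \<open>\<Sum> \<sigma> \<Lambda>\<^sub>1 P \<rho> (\<S> \<Lambda>\<^sub>2)\<close> of the matrix unit \<open>P\<close> at \<open>(i, j)\<close>, for the
  integral \<open>\<Lambda>\<close>.
\<close>

definition averaging :: "('h, 'k) rep \<Rightarrow> ('h, 'k) rep \<Rightarrow> nat \<Rightarrow> nat \<Rightarrow> nat \<Rightarrow> nat \<Rightarrow> 'k" where
  "averaging \<rho> \<sigma> p q i j = sweedler integral (\<lambda>a b. \<sigma> a $$ (p, i) * \<rho> (\<S> b) $$ (j, q))"

text \<open>
  The dimension of the space of homomorphisms from \<open>\<rho>\<close> to \<open>\<sigma>\<close>, seen in the field and expressed by
  characters.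
\<close>

definition pairing :: "('h, 'k) rep \<Rightarrow> ('h, 'k) rep \<Rightarrow> 'k" where
  "pairing \<rho> \<sigma> = sweedler integral (\<lambda>a b. mat_trace (\<sigma> a) * mat_trace (\<rho> (\<S> b)))"

lemma pairing_eq_trace_averaging:
  assumes "is_module \<rho>" "is_module \<sigma>"
  shows "pairing \<rho> \<sigma> = (\<Sum>p<rdim \<sigma>. \<Sum>q<rdim \<rho>. averaging \<rho> \<sigma> p q p q)"
  using assms
  by (simp add: pairing_def averaging_def mat_trace_def sum_product sweedler_sum)

text \<open>
  Together with \<open>averaging_fixes_hom\<close>: averaging is a projection onto the homomorphisms.
\<close>

lemma averaging_hom:
  assumes "is_module \<rho>" "is_module \<sigma>" "i < rdim \<sigma>" "j < rdim \<rho>"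
  shows "hom_entries \<rho> \<sigma> (\<lambda>p q. averaging \<rho> \<sigma> p q i j)"
  unfolding hom_entries_def
proof (intro allI impI)
  fix h p q assume p: "p < rdim \<sigma>" and q: "q < rdim \<rho>"
  have "(\<Sum>k<rdim \<sigma>. \<sigma> h $$ (p, k) * averaging \<rho> \<sigma> k q i j)
      = sweedler integral (\<lambda>a b. \<sigma> (h * a) $$ (p, i) * \<rho> (\<S> b) $$ (j, q))"
    unfolding averaging_def module_mult[OF assms(2) p assms(3)]
    by (simp add: sum_distrib_right sweedler_sum mult.assoc flip: sweedler_cmult)
  also have "\<dots> = sweedler integral (\<lambda>a b. \<sigma> a $$ (p, i) * \<rho> (\<S> b * h) $$ (j, q))"
    by (rule integral_transfer[OF integral(1), of "\<lambda>a b. \<sigma> a $$ (p, i) * \<rho> b $$ (j, q)"])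
      (use assms p q in \<open>simp add: balanced_def module_add module_scale algebra_simps\<close>)
  also have "\<dots> = (\<Sum>k<rdim \<rho>. averaging \<rho> \<sigma> p k i j * \<rho> h $$ (k, q))"
    unfolding averaging_def module_mult[OF assms(1,4) q]
    by (simp add: sum_distrib_left sweedler_sum flip: sweedler_cmult_right mult.assoc)
  finally show "(\<Sum>k<rdim \<sigma>. \<sigma> h $$ (p, k) * averaging \<rho> \<sigma> k q i j)
     = (\<Sum>k<rdim \<rho>. averaging \<rho> \<sigma> p k i j * \<rho> h $$ (k, q))" .
qed

lemma sweedler_integral_antipode:
  assumes \<rho>: "is_module \<rho>" and k: "k < rdim \<rho>" and q: "q < rdim \<rho>"
  shows "sweedler integral (\<lambda>a b. \<Sum>j<rdim \<rho>. \<rho> a $$ (k, j) * \<rho> (\<S> b) $$ (j, q)) =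
    (if k = q then 1 else 0)"
proof -
  have "sweedler integral (\<lambda>a b. \<Sum>j<rdim \<rho>. \<rho> a $$ (k, j) * \<rho> (\<S> b) $$ (j, q))
      = sweedler integral (\<lambda>a b. \<rho> (a * \<S> b) $$ (k, q))"
    by (simp add: module_mult[OF assms])
  also have "\<dots> = \<rho> (scale (\<epsilon> integral) 1) $$ (k, q)"
    by (rule sweedler_antipode_right) (simp add: module_add[OF assms])
  also have "\<dots> = (if k = q then 1 else 0)"
    by (simp add: integral(2) module_one[OF assms])
  finally show ?thesis .
qed

lemma averaging_fixes_hom:
  assumes \<rho>: "is_module \<rho>" and hom: "hom_entries \<rho> \<sigma> P" and p: "p < rdim \<sigma>" and q: "q < rdim \<rho>"
  shows "(\<Sum>i<rdim \<sigma>. \<Sum>j<rdim \<rho>. averaging \<rho> \<sigma> p q i j * P i j) = P p q"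
proof -
  have "(\<Sum>i<rdim \<sigma>. \<Sum>j<rdim \<rho>. averaging \<rho> \<sigma> p q i j * P i j)
      = sweedler integral (\<lambda>a b. \<Sum>i<rdim \<sigma>. \<Sum>j<rdim \<rho>. \<sigma> a $$ (p, i) * \<rho> (\<S> b) $$ (j, q) * P i j)"
    unfolding averaging_def by (simp only: sweedler_sum sweedler_cmult_right)
  also have "\<dots> = sweedler integral
      (\<lambda>a b. \<Sum>j<rdim \<rho>. (\<Sum>i<rdim \<sigma>. \<sigma> a $$ (p, i) * P i j) * \<rho> (\<S> b) $$ (j, q))"
    by (subst sum.swap) (simp add: sum_distrib_left sum_distrib_right ac_simps)
  also have "\<dots> = sweedler integral
      (\<lambda>a b. \<Sum>j<rdim \<rho>. (\<Sum>k<rdim \<rho>. P p k * \<rho> a $$ (k, j)) * \<rho> (\<S> b) $$ (j, q))"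
    using hom p unfolding hom_entries_def by (intro arg_cong[of _ _ "sweedler integral"] ext sum.cong) auto
  also have "\<dots> = sweedler integral
      (\<lambda>a b. \<Sum>k<rdim \<rho>. P p k * (\<Sum>j<rdim \<rho>. \<rho> a $$ (k, j) * \<rho> (\<S> b) $$ (j, q)))"
    unfolding sum_distrib_left sum_distrib_right by (subst sum.swap) (simp add: mult.assoc)
  also have "\<dots> = (\<Sum>k<rdim \<rho>. P p k * (if k = q then 1 else 0))"
    unfolding sweedler_sum sweedler_cmult
    by (rule sum.cong) (simp_all add: sweedler_integral_antipode[OF \<rho> _ q] flip: sweedler_sum)
  also have "\<dots> = (\<Sum>k<rdim \<rho>. if k = q then P p q else 0)" by (rule sum.cong) auto
  also have "\<dots> = P p q" using q by simp
  finally show ?thesis .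
qed

lemma pairing_cong:
  assumes "is_module \<rho>" "is_module \<rho>'" "is_module \<sigma>" "is_module \<sigma>'" "rep_iso \<rho> \<rho>'" "rep_iso \<sigma> \<sigma>'"
  shows "pairing \<rho> \<sigma> = pairing \<rho>' \<sigma>'"
  unfolding pairing_def
  using module_iso_trace[OF assms(1,2,5)] module_iso_trace[OF assms(3,4,6)] by simp

lemma pairing_sum_left:
  assumes "\<And>h. mat_trace (\<rho> h) = (\<Sum>V\<leftarrow>Vs. mat_trace (V h))"
  shows "pairing \<rho> \<sigma> = (\<Sum>V\<leftarrow>Vs. pairing V \<sigma>)"
  unfolding pairing_def assms
  by (induction Vs) (simp_all add: sweedler_zero sweedler_plus distrib_left)

lemma pairing_sum_right:
  assumes "\<And>h. mat_trace (\<sigma> h) = (\<Sum>V\<leftarrow>Vs. mat_trace (V h))"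
  shows "pairing \<rho> \<sigma> = (\<Sum>V\<leftarrow>Vs. pairing \<rho> V)"
  unfolding pairing_def assms
  by (induction Vs) (simp_all add: sweedler_zero sweedler_plus distrib_right)

end

section \<open>Schur's lemma and orthogonality of simple modules\<close>

context semisimple_hopf_algebra
begin

text \<open>
  Kernel and image of a nonzero intertwiner of simple modules are a zero and a full submodule.
\<close>

lemma schur_iso:
  assumes \<rho>: "simple_module \<rho>" and \<sigma>: "simple_module \<sigma>" and P: "P \<in> carrier_mat (rdim \<sigma>) (rdim \<rho>)"
    and com: "\<And>h. \<sigma> h * P = P * \<rho> h" and nz: "P \<noteq> 0\<^sub>m (rdim \<sigma>) (rdim \<rho>)"
  shows "rep_iso \<rho> \<sigma>"
proof -
  let ?r = "rdim \<rho>" and ?s = "rdim \<sigma>"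
  have m: "is_module \<rho>" "is_module \<sigma>" using \<rho> \<sigma> by (auto simp: simple_module_def)
  note c = module_carrier[OF m(1)] module_carrier[OF m(2)]
  let ?K = "{v \<in> carrier_vec ?r. P *\<^sub>v v = 0\<^sub>v ?s}"
  let ?I = "{P *\<^sub>v v | v. v \<in> carrier_vec ?r}"
  have Pnz: "\<exists>v\<in>carrier_vec ?r. P *\<^sub>v v \<noteq> 0\<^sub>v ?s"
  proof (rule ccontr)
    assume "\<not> ?thesis"
    then have "P *\<^sub>v unit_vec ?r j = 0\<^sub>v ?s" for j by auto
    then have "col P j = 0\<^sub>v ?s" if "j < ?r" for j
      using that P col_mult2[of P ?s ?r "1\<^sub>m ?r" ?r j] by simp
    then have "P = 0\<^sub>m ?s ?r"
      using P by (intro eq_matI) (auto dest!: arg_cong[of _ _ "\<lambda>v. v $ _"] simp: col_def vec_eq_iff)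
    with nz show False by simp
  qed
  have act: "P *\<^sub>v (\<rho> h *\<^sub>v v) = \<sigma> h *\<^sub>v (P *\<^sub>v v)" if "v \<in> carrier_vec ?r" for h v
    using assoc_mult_mat_vec[OF P c(1) that] assoc_mult_mat_vec[OF c(2) P that] com by metis
  have \<sigma>0: "\<sigma> h *\<^sub>v 0\<^sub>v ?s = 0\<^sub>v ?s" for h using c(2)[of h] by auto
  have "submodule \<rho> ?K"
    unfolding submodule_def using P c \<sigma>0
    by (auto simp: act mult_add_distrib_mat_vec[OF P] mult_mat_vec[OF P] intro: mult_mat_vec_carrier)
  moreover have "?K \<noteq> carrier_vec ?r" using Pnz by blast
  ultimately have K: "?K = {0\<^sub>v ?r}" using \<rho> unfolding simple_module_def by blast
  have "submodule \<sigma> ?I"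
    unfolding submodule_def
  proof (intro conjI ballI allI)
    show "?I \<subseteq> carrier_vec ?s" using P by auto
    show "0\<^sub>v ?s \<in> ?I" using P by (auto intro!: exI[of _ "0\<^sub>v ?r"])
    fix x y assume "x \<in> ?I" "y \<in> ?I"
    then show "x + y \<in> ?I" using P by (auto simp flip: mult_add_distrib_mat_vec)
  next
    fix c x assume "x \<in> ?I"
    then show "c \<cdot>\<^sub>v x \<in> ?I" using P by (auto simp flip: mult_mat_vec)
  next
    fix h x assume "x \<in> ?I"
    then obtain v where v: "v \<in> carrier_vec ?r" "x = P *\<^sub>v v" by blast
    then have "\<sigma> h *\<^sub>v x = P *\<^sub>v (\<rho> h *\<^sub>v v)" by (simp add: act)
    moreover have "\<rho> h *\<^sub>v v \<in> carrier_vec ?r" using c(1) v(1) by (rule mult_mat_vec_carrier)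
    ultimately show "\<sigma> h *\<^sub>v x \<in> ?I" by blast
  qed
  moreover have "?I \<noteq> {0\<^sub>v ?s}" using Pnz by blast
  ultimately have I: "?I = carrier_vec ?s" using \<sigma> unfolding simple_module_def by blast
  \<comment> \<open>Surjectivity gives a right inverse of \<open>P\<close>, column by column; injectivity makes it two-sided.\<close>
  have "\<forall>j. \<exists>v\<in>carrier_vec ?r. P *\<^sub>v v = unit_vec ?s j" 
  proof
    fix j have "unit_vec ?s j \<in> ?I" unfolding I by simp
    then show "\<exists>v\<in>carrier_vec ?r. P *\<^sub>v v = unit_vec ?s j" by auto
  qed
  then obtain w where w: "\<And>j. w j \<in> carrier_vec ?r" "\<And>j. P *\<^sub>v w j = unit_vec ?s j" by metis
  define Q where "Q = mat ?r ?s (\<lambda>(i, j). w j $ i)"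
  have Q: "Q \<in> carrier_mat ?r ?s" by (simp add: Q_def)
  have PQ: "P * Q = 1\<^sub>m ?s"
  proof (rule mat_col_eqI)
    fix j assume "j < dim_col (1\<^sub>m ?s)"
    then have j: "j < ?s" by simp
    have "col Q j = w j" using j w(1)[of j] by (intro eq_vecI) (auto simp: Q_def)
    then show "col (P * Q) j = col (1\<^sub>m ?s) j"
      unfolding col_mult2[OF P Q j] using w(2) j by simp
  qed (use P Q in auto)
  have QP: "Q * P = 1\<^sub>m ?r"
  proof (rule mat_col_eqI)
    fix j assume "j < dim_col (1\<^sub>m ?r)"
    then have j: "j < ?r" by simp
    have QPc: "Q * P \<in> carrier_mat ?r ?r" using P Q by (rule mult_carrier_mat[rotated])
    have "P * (Q * P - 1\<^sub>m ?r) = P * (Q * P) - P * 1\<^sub>m ?r"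
      using P QPc by (rule mult_minus_distrib_mat) simp
    also have "P * (Q * P) = (P * Q) * P" using P Q by (intro assoc_mult_mat[symmetric])
    also have "(P * Q) * P - P * 1\<^sub>m ?r = 0\<^sub>m ?s ?r" using P by (simp add: PQ)
    finally have z: "P * (Q * P - 1\<^sub>m ?r) = 0\<^sub>m ?s ?r" .
    have dc: "Q * P - 1\<^sub>m ?r \<in> carrier_mat ?r ?r" by (rule minus_carrier_mat) simp
    have "P *\<^sub>v col (Q * P - 1\<^sub>m ?r) j = 0\<^sub>v ?s"
      using col_mult2[OF P dc j] j by (simp add: z)
    then have "col (Q * P - 1\<^sub>m ?r) j \<in> ?K" using col_carrier_vec[OF j dc] by simp
    then have "col (Q * P - 1\<^sub>m ?r) j = 0\<^sub>v ?r" unfolding K by simp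
    then have "(Q * P - 1\<^sub>m ?r) $$ (i, j) = 0" if "i < ?r" for i
      using that j index_col[of i "Q * P - 1\<^sub>m ?r" j] by simp
    then show "col (Q * P) j = col (1\<^sub>m ?r) j"
      using j carrier_matD[OF QPc] by (intro eq_vecI) (simp_all add: col_def del: index_mult_mat)
  qed (use P Q in auto)
  \<comment> \<open>The dimensions agree because \<open>P * Q\<close> and \<open>Q * P\<close> have the same trace and the characteristic is \<open>0\<close>.\<close>
  have "of_nat ?s = mat_trace (P * Q)" by (simp add: PQ mat_trace_def)
  also have "\<dots> = mat_trace (Q * P)" by (rule mat_trace_comm[OF P Q])
  also have "\<dots> = of_nat ?r" by (simp add: QP mat_trace_def)
  finally have "(of_nat ?s :: 'k) = of_nat ?r" .
  then have "?s = ?r" by (rule of_nat_eq_iff[THEN iffD1])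
  then show ?thesis
    using P Q PQ QP com by (intro rep_isoI[of _ ?r _ P Q]) auto
qed

text \<open>
  The matrix has an eigenvalue over the algebraically closed field, and the eigenspace is a submodule.
\<close>

lemma schur_scalar:
  assumes \<rho>: "simple_module \<rho>" and P: "P \<in> carrier_mat (rdim \<rho>) (rdim \<rho>)"
    and com: "\<And>h. \<rho> h * P = P * \<rho> h"
  shows "\<exists>c. P = c \<cdot>\<^sub>m 1\<^sub>m (rdim \<rho>)"
proof -
  let ?r = "rdim \<rho>"
  have m: "is_module \<rho>" and r: "?r > 0" using \<rho> by (auto simp: simple_module_def)
  note c = module_carrier[OF m]
  have "degree (char_poly P) > 0" using degree_monic_char_poly[OF P] r by simp
  then obtain e where "poly (char_poly P) e = 0" using alg_closed_imp_poly_has_root by blast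
  then obtain v where v: "v \<in> carrier_vec ?r" "v \<noteq> 0\<^sub>v ?r" "P *\<^sub>v v = e \<cdot>\<^sub>v v"
    using eigenvalue_root_char_poly[OF P] P by (auto simp: eigenvalue_def eigenvector_def)
  let ?W = "{v \<in> carrier_vec ?r. P *\<^sub>v v = e \<cdot>\<^sub>v v}"
  have act: "P *\<^sub>v (\<rho> h *\<^sub>v v) = \<rho> h *\<^sub>v (P *\<^sub>v v)" if "v \<in> carrier_vec ?r" for h v
    using assoc_mult_mat_vec[OF P c that] assoc_mult_mat_vec[OF c P that] com by metis
  have "submodule \<rho> ?W"
    unfolding submodule_def using P c
    by (auto simp: act mult_add_distrib_mat_vec[OF P] mult_mat_vec[OF P] mult_mat_vec[OF c]
      smult_add_distrib_vec smult_smult_assoc mult.commute intro: mult_mat_vec_carrier)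
  moreover have "?W \<noteq> {0\<^sub>v ?r}" using v by blast
  ultimately have W: "?W = carrier_vec ?r" using \<rho> unfolding simple_module_def by blast
  have "P = e \<cdot>\<^sub>m 1\<^sub>m ?r"
  proof (rule mat_col_eqI)
    fix j assume "j < dim_col (e \<cdot>\<^sub>m 1\<^sub>m ?r)"
    then have j: "j < ?r" by simp
    have "unit_vec ?r j \<in> ?W" unfolding W by simp
    then have "P *\<^sub>v unit_vec ?r j = e \<cdot>\<^sub>v unit_vec ?r j" by simp
    then show "col P j = col (e \<cdot>\<^sub>m 1\<^sub>m ?r) j"
      using col_mult2[OF P one_carrier_mat j] P j by simp
  qed (use P in auto)
  then show ?thesis by blast
qed

lemma pairing_simple_noniso:
  assumes \<rho>: "simple_module \<rho>" and \<sigma>: "simple_module \<sigma>" and "\<not> rep_iso \<rho> \<sigma>"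
  shows "pairing \<rho> \<sigma> = 0"
proof -
  have m: "is_module \<rho>" "is_module \<sigma>" using \<rho> \<sigma> by (auto simp: simple_module_def)
  have "averaging \<rho> \<sigma> p q p q = 0" if pq: "p < rdim \<sigma>" "q < rdim \<rho>" for p q
  proof -
    let ?P = "mat (rdim \<sigma>) (rdim \<rho>) (\<lambda>(i, j). averaging \<rho> \<sigma> i j p q)"
    have "?P = 0\<^sub>m (rdim \<sigma>) (rdim \<rho>)"
      using schur_iso[OF \<rho> \<sigma> _ hom_entries_mat[OF m averaging_hom[OF m pq]]] assms(3) by auto
    then have "?P $$ (p, q) = 0" using pq by simp
    then show ?thesis using pq by simp
  qed
  then show ?thesis unfolding pairing_eq_trace_averaging[OF m] by simp
qed

text \<open>
  By Schur's lemma every average is a scalar matrix, so the averaging operator has rank one, and it fixes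
  the identity matrix.
\<close>

lemma pairing_simple_self:
  assumes \<rho>: "simple_module \<rho>"
  shows "pairing \<rho> \<rho> = 1"
proof -
  let ?r = "rdim \<rho>"
  have m: "is_module \<rho>" and r: "?r > 0" using \<rho> by (auto simp: simple_module_def)
  have "\<exists>c. \<forall>p<?r. \<forall>q<?r. averaging \<rho> \<rho> p q i j = (if p = q then c else 0)"
    if ij: "i < ?r" "j < ?r" for i j
  proof -
    let ?P = "mat ?r ?r (\<lambda>(p, q). averaging \<rho> \<rho> p q i j)"
    obtain c where c: "?P = c \<cdot>\<^sub>m 1\<^sub>m ?r"
      using schur_scalar[OF \<rho> _ hom_entries_mat[OF m m averaging_hom[OF m m ij]]] by auto
    have "averaging \<rho> \<rho> p q i j = (if p = q then c else 0)" if "p < ?r" "q < ?r" for p q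
      using that arg_cong[OF c, of "\<lambda>M. M $$ (p, q)"] by (simp split: if_splits)
    then show ?thesis by blast
  qed
  \<comment> \<open>Averaging the matrix unit \<open>(i, j)\<close> gives the scalar \<open>c i j\<close>; the identity is its own average, so that
    the diagonal entries of \<open>c\<close> sum to \<open>1\<close>.\<close>
  then obtain c where c: "\<And>i j p q. i < ?r \<Longrightarrow> j < ?r \<Longrightarrow> p < ?r \<Longrightarrow> q < ?r \<Longrightarrow>
      averaging \<rho> \<rho> p q i j = (if p = q then c i j else 0)" by metis
  have id: "hom_entries \<rho> \<rho> (\<lambda>i j. if i = j then 1 else 0)"
    by (simp add: hom_entries_def if_distrib[of "\<lambda>x. _ * x"] if_distrib[of "\<lambda>x. x * _"] cong: if_cong)
  have "pairing \<rho> \<rho> = (\<Sum>p<?r. \<Sum>q<?r. if p = q then c p q else 0)"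
    unfolding pairing_eq_trace_averaging[OF m m] by (intro sum.cong) (auto simp: c)
  also have "\<dots> = (\<Sum>p<?r. \<Sum>q<?r. averaging \<rho> \<rho> 0 0 p q * (if p = q then 1 else 0))"
    by (intro sum.cong) (auto simp: c r)
  also have "\<dots> = 1"
    using averaging_fixes_hom[OF m id r r] by simp
  finally show ?thesis .
qed

lemma pairing_simple:
  assumes \<rho>: "simple_module \<rho>" and \<sigma>: "simple_module \<sigma>"
  shows "pairing \<rho> \<sigma> = (if rep_iso \<rho> \<sigma> then 1 else 0)"
proof -
  have m: "is_module \<rho>" "is_module \<sigma>" using \<rho> \<sigma> by (auto simp: simple_module_def)
  show ?thesis
    using pairing_cong[OF m(1) m(1) m(1) m(2) module_iso_refl[OF m(1)]]
      pairing_simple_self[OF \<rho>] pairing_simple_noniso[OF \<rho> \<sigma>] by auto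
qed

end

section \<open>Complete reducibility and multiplicities\<close>

context hopf_algebra
begin

lemma rep_ring_eq_refl [simp]: "rep_ring_eq x x"
  by (simp add: rep_ring_eq_def)

lemma rep_ring_eq_sym: "rep_ring_eq x y \<Longrightarrow> rep_ring_eq y x"
  unfolding rep_ring_eq_def by (metis group_closure_minus_iff minus_diff_eq)

lemma rep_ring_eq_trans [trans]: "rep_ring_eq x y \<Longrightarrow> rep_ring_eq y z \<Longrightarrow> rep_ring_eq x z"
  unfolding rep_ring_eq_def using group_closure_add[of "x - y" _ "y - z"] by simp

lemma rep_ring_eq_add: "rep_ring_eq x y \<Longrightarrow> rep_ring_eq x' y' \<Longrightarrow> rep_ring_eq (x + x') (y + y')"
  unfolding rep_ring_eq_def using group_closure_add[of "x - y" _ "x' - y'"] by (simp add: algebra_simps)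

lemma rep_ring_eq_sum:
  "(\<And>i. i \<in> I \<Longrightarrow> rep_ring_eq (x i) (y i)) \<Longrightarrow> rep_ring_eq (\<Sum>i\<in>I. x i) (\<Sum>i\<in>I. y i)"
  by (induction I rule: infinite_finite_induct) (auto intro: rep_ring_eq_add)

lemma rep_ring_eq_cmul:
  assumes "rep_ring_eq x y"
  shows "rep_ring_eq (frag_cmul (int k) x) (frag_cmul (int k) y)"
  using assms
  by (induction k) (simp_all add: frag_cmul_distrib rep_ring_eq_add)

lemma rep_ring_eq_iso:
  "is_module \<rho> \<Longrightarrow> is_module \<sigma> \<Longrightarrow> rep_iso \<rho> \<sigma> \<Longrightarrow> rep_ring_eq (frag_of \<rho>) (frag_of \<sigma>)"
  unfolding rep_ring_eq_def rep_ring_relations_def by (rule group_closure.base) blast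

lemma rep_ring_eq_rep_sum:
  assumes "is_module \<rho>" "is_module \<sigma>"
  shows "rep_ring_eq (frag_of (rep_sum \<rho> \<sigma>)) (frag_of \<rho> + frag_of \<sigma>)"
proof -
  have "frag_of (rep_sum \<rho> \<sigma>) - frag_of \<rho> - frag_of \<sigma> \<in> group_closure rep_ring_relations"
    unfolding rep_ring_relations_def using assms by (intro group_closure.base) blast
  then show ?thesis by (simp add: rep_ring_eq_def algebra_simps)
qed

text \<open>
  A module of dimension \<open>0\<close> equals its own double, so its class cancels.
\<close>

lemma rep_ring_eq_zero_module:
  assumes "is_module \<rho>" "rdim \<rho> = 0"
  shows "rep_ring_eq (frag_of \<rho>) 0"
proof -
  \<comment> \<open>Doubling an empty matrix gives the empty matrix.\<close>
  have "rep_sum \<rho> \<rho> = \<rho>"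
    using assms rep_sum_carrier[OF assms(1,1)] by (intro ext eq_matI) auto
  then have "rep_ring_eq (frag_of \<rho>) (frag_of \<rho> + frag_of \<rho>)"
    using rep_ring_eq_rep_sum[OF assms(1,1)] by simp
  then show ?thesis by (simp add: rep_ring_eq_def)
qed

end

context semisimple_hopf_algebra
begin

text \<open>
  Maschke's argument: averaging a projection onto the submodule gives an equivariant one, whose kernel is
  a complement.
\<close>

lemma block_triangular_splits:
  assumes \<rho>: "is_module \<rho>" and d: "rdim \<rho> = r + e"
    and tri: "\<And>h i j. i < e \<Longrightarrow> j < r \<Longrightarrow> \<rho> h $$ (r + i, j) = 0"
  shows "\<exists>\<alpha> \<gamma>. is_module \<alpha> \<and> is_module \<gamma> \<and> rdim \<alpha> = r \<and> rdim \<gamma> = e \<and> rep_iso \<rho> (rep_sum \<alpha> \<gamma>)"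
proof -
  define \<alpha> where "\<alpha> h = mat r r (\<lambda>(i, j). \<rho> h $$ (i, j))" for h
  define \<gamma> where "\<gamma> h = mat e e (\<lambda>(i, j). \<rho> h $$ (r + i, r + j))" for h
  note en = module_entry[OF \<rho>, unfolded d]
  have \<alpha>: "is_module \<alpha>"
    by (rule is_moduleI[of _ r]) (simp_all add: \<alpha>_def en sum_lessThan_add tri)
  have \<gamma>: "is_module \<gamma>"
    by (rule is_moduleI[of _ e]) (simp_all add: \<gamma>_def en sum_lessThan_add tri)
  have dims: "rdim \<alpha> = r" "rdim \<gamma> = e" by (simp_all add: rdim_def \<alpha>_def \<gamma>_def)
  \<comment> \<open>\<open>\<pi>\<close> is the average of the coordinate projection to the first \<open>r\<close> entries; it is still the identity
    there, because \<open>\<rho>\<close> acts on them through \<open>\<alpha>\<close>.\<close>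
  define \<pi> where "\<pi> p q = (\<Sum>i<r. averaging \<rho> \<alpha> p q i i)" for p q
  have hom: "hom_entries \<rho> \<alpha> \<pi>"
    unfolding \<pi>_def by (intro hom_entries_sum averaging_hom \<rho> \<alpha>) (auto simp: d dims)
  have \<pi>_id: "\<pi> p q = (if p = q then 1 else 0)" if "p < r" "q < r" for p q
  proof -
    have "\<pi> p q = sweedler integral (\<lambda>a b. \<Sum>i<rdim \<alpha>. \<alpha> a $$ (p, i) * \<alpha> (\<S> b) $$ (i, q))"
      unfolding \<pi>_def averaging_def sweedler_sum dims
      by (intro sum.cong arg_cong[of _ _ "sweedler integral"] ext) (auto simp: \<alpha>_def that)
    then show ?thesis using sweedler_integral_antipode[OF \<alpha>] that by (simp add: dims)
  qed
  \<comment> \<open>\<open>T\<close> is unitriangular: \<open>\<pi>\<close> on top of the projection to the last \<open>e\<close> entries.\<close>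
  define T where "T = mat (r + e) (r + e) (\<lambda>(p, q). if p < r then \<pi> p q else if p = q then 1 else 0)"
  have T: "T \<in> carrier_mat (r + e) (r + e)" by (simp add: T_def)
  have inj: "v = 0\<^sub>v (r + e)" if v: "v \<in> carrier_vec (r + e)" and Tv: "T *\<^sub>v v = 0\<^sub>v (r + e)" for v
  proof -
    have row: "(\<Sum>q<r + e. T $$ (p, q) * v $ q) = 0" if "p < r + e" for p
      using index_mult_mat_vec_sum[OF T v that] Tv that by simp
    have low: "v $ p = 0" if p: "r \<le> p" "p < r + e" for p
    proof -
      have "(\<Sum>q<r + e. T $$ (p, q) * v $ q) = (\<Sum>q<r + e. if q = p then v $ p else 0)"
        by (rule sum.cong) (use p in \<open>auto simp: T_def\<close>)
      then show ?thesis using row[OF p(2)] p by simp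
    qed
    have "v $ p = 0" if p: "p < r" for p
    proof -
      have "(\<Sum>q<r + e. T $$ (p, q) * v $ q) = (\<Sum>q<r + e. if q = p then v $ p else 0)"
      proof (rule sum.cong)
        fix q assume "q \<in> {..<r + e}"
        then show "T $$ (p, q) * v $ q = (if q = p then v $ p else 0)"
          using p low[of q] \<pi>_id[of p q] by (cases "q < r") (auto simp: T_def)
      qed simp
      then show ?thesis using row[of p] p by simp
    qed
    then show ?thesis using low v by (intro eq_vecI) (auto simp: not_less[symmetric])
  qed
  obtain T' where T': "T' \<in> carrier_mat (r + e) (r + e)" "T * T' = 1\<^sub>m (r + e)" "T' * T = 1\<^sub>m (r + e)"
    using injective_mat_inverse[OF T inj] by blast
  have sc: "rep_sum \<alpha> \<gamma> h \<in> carrier_mat (r + e) (r + e)" for h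
    using rep_sum_carrier[OF \<alpha> \<gamma>] by (simp add: dims)
  have \<rho>c: "\<rho> h \<in> carrier_mat (r + e) (r + e)" for h
    using module_carrier[OF \<rho>] by (simp add: d)
  have "rep_iso \<rho> (rep_sum \<alpha> \<gamma>)"
  proof (rule rep_isoI[OF d _ T T'])
    show "rdim (rep_sum \<alpha> \<gamma>) = r + e" by (simp add: rdim_rep_sum \<alpha> \<gamma> dims)
    fix h
    show "T * \<rho> h = rep_sum \<alpha> \<gamma> h * T"
    proof (rule eq_matI)
      fix p q assume "p < dim_row (rep_sum \<alpha> \<gamma> h * T)" "q < dim_col (rep_sum \<alpha> \<gamma> h * T)"
      then have pq: "p < r + e" "q < r + e" using sc[of h] T by auto
      note se = rep_sum_entry[OF \<alpha> \<gamma>, unfolded dims]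
      show "(T * \<rho> h) $$ (p, q) = (rep_sum \<alpha> \<gamma> h * T) $$ (p, q)"
      proof (cases "p < r")
        case True
        have "(T * \<rho> h) $$ (p, q) = (\<Sum>k<r + e. \<pi> p k * \<rho> h $$ (k, q))"
          unfolding index_mult_mat_sum[OF T \<rho>c pq] using True by (simp add: T_def)
        also have "\<dots> = (\<Sum>k<r. \<alpha> h $$ (p, k) * \<pi> k q)"
          using hom True pq unfolding hom_entries_def by (simp add: d dims)
        also have "\<dots> = (rep_sum \<alpha> \<gamma> h * T) $$ (p, q)"
          unfolding index_mult_mat_sum[OF sc T pq] using True pq by (simp add: sum_lessThan_add se T_def)
        finally show ?thesis .
      next
        case False
        then obtain i where i: "p = r + i" "i < e" using pq by (metis add_less_cancel_left le_Suc_ex not_less)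
        have "(T * \<rho> h) $$ (p, q) = (\<Sum>k<r + e. if k = p then \<rho> h $$ (p, q) else 0)"
          unfolding index_mult_mat_sum[OF T \<rho>c pq]
          by (rule sum.cong) (use False pq in \<open>auto simp: T_def\<close>)
        also have "\<dots> = \<rho> h $$ (p, q)" using pq by simp
        also have "\<dots> = (\<Sum>k<e. \<gamma> h $$ (i, k) * (if r + k = q then 1 else 0))"
        proof (cases "q < r")
          case True
          then show ?thesis using i tri by simp
        next
          case False
          then obtain j where j: "q = r + j" "j < e"
            using pq by (metis add_less_cancel_left le_Suc_ex not_less)
          have "(\<Sum>k<e. \<gamma> h $$ (i, k) * (if r + k = q then 1 else 0)) =
              (\<Sum>k<e. if k = j then \<gamma> h $$ (i, j) else 0)"
            by (rule sum.cong) (auto simp: j)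
          then show ?thesis using i j by (simp add: \<gamma>_def)
        qed
        also have "\<dots> = (rep_sum \<alpha> \<gamma> h * T) $$ (p, q)"
          unfolding index_mult_mat_sum[OF sc T pq] using i pq by (simp add: sum_lessThan_add se T_def)
        finally show ?thesis .
      qed
    qed (use T \<rho>c[of h] sc[of h] in auto)
  qed
  then show ?thesis using \<alpha> \<gamma> dims by blast
qed

text \<open>
  A basis of the submodule, extended to the whole space, makes the action block triangular.
\<close>

lemma submodule_splits:
  assumes \<rho>: "is_module \<rho>" and W: "submodule \<rho> W" "W \<noteq> {0\<^sub>v (rdim \<rho>)}" "W \<noteq> carrier_vec (rdim \<rho>)"
  shows "\<exists>\<alpha> \<gamma>. is_module \<alpha> \<and> is_module \<gamma> \<and> rdim \<alpha> < rdim \<rho> \<and> rdim \<gamma> < rdim \<rho> \<and>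
    rep_iso \<rho> (rep_sum \<alpha> \<gamma>)"
proof -
  let ?d = "rdim \<rho>"
  note Wd = W(1)[unfolded submodule_def]
  have Wc: "W \<subseteq> carrier_vec ?d" using Wd by blast
  obtain r Q Q' where r: "r \<le> ?d" and Q: "Q \<in> carrier_mat ?d ?d" "Q' \<in> carrier_mat ?d ?d"
    "Q * Q' = 1\<^sub>m ?d" "Q' * Q = 1\<^sub>m ?d" and cols: "\<And>j. j < r \<Longrightarrow> col Q j \<in> W"
    and lower: "\<And>w i. w \<in> W \<Longrightarrow> r \<le> i \<Longrightarrow> i < ?d \<Longrightarrow> (Q' *\<^sub>v w) $ i = 0"
    using adapted_basis[OF Wc] by blast
  have Qinv: "Q *\<^sub>v (Q' *\<^sub>v w) = w" if "w \<in> carrier_vec ?d" for w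
    using Q that by (simp flip: assoc_mult_mat_vec[of Q ?d ?d Q' ?d])
  \<comment> \<open>\<open>W\<close> is the span of the first \<open>r\<close> columns of \<open>Q\<close>, so neither block is empty.\<close>
  have "r \<noteq> 0"
  proof
    assume "r = 0"
    have "w = 0\<^sub>v ?d" if w: "w \<in> W" for w
    proof -
      have wc: "w \<in> carrier_vec ?d" using Wc w by blast
      have "Q' *\<^sub>v w = 0\<^sub>v ?d"
        using Q(2) lower[OF w] \<open>r = 0\<close> by (intro eq_vecI) auto
      then show ?thesis using Qinv[OF wc] Q(1) by auto
    qed
    moreover have "0\<^sub>v ?d \<in> W" using Wd by blast
    ultimately show False using W(2) by blast
  qed
  have "r \<noteq> ?d"
  proof
    assume rd: "r = ?d"
    have "Q *\<^sub>v v \<in> W" if v: "v \<in> carrier_vec ?d" for v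
    proof -
      have "vec ?d (\<lambda>i. \<Sum>j<n. Q $$ (i, j) * v $ j) \<in> W" if "n \<le> ?d" for n
        using that
      proof (induction n)
        case 0
        have "vec ?d (\<lambda>i. \<Sum>j<0. Q $$ (i, j) * v $ j) = 0\<^sub>v ?d" by (intro eq_vecI) auto
        then show ?case using Wd by simp
      next
        case (Suc n)
        then have "vec ?d (\<lambda>i. \<Sum>j<n. Q $$ (i, j) * v $ j) + v $ n \<cdot>\<^sub>v col Q n \<in> W"
          using Wd cols[of n] rd by auto
        also have "vec ?d (\<lambda>i. \<Sum>j<n. Q $$ (i, j) * v $ j) + v $ n \<cdot>\<^sub>v col Q n =
            vec ?d (\<lambda>i. \<Sum>j<Suc n. Q $$ (i, j) * v $ j)"
          using Q(1) Suc.prems by (intro eq_vecI) auto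
        finally show ?case .
      qed
      from this[of ?d] have "vec ?d (\<lambda>i. \<Sum>j<?d. Q $$ (i, j) * v $ j) \<in> W" by simp
      also have "vec ?d (\<lambda>i. \<Sum>j<?d. Q $$ (i, j) * v $ j) = Q *\<^sub>v v"
        using Q(1) v by (intro eq_vecI) (auto simp: scalar_prod_def atLeast0LessThan)
      finally show ?thesis .
    qed
    then have "carrier_vec ?d \<subseteq> W"
      using Qinv Q(2) by (metis mult_mat_vec_carrier subsetI)
    then show False using W(3) Wc by blast
  qed
  define \<rho>' where "\<rho>' h = Q' * \<rho> h * Q" for h
  have \<rho>': "is_module \<rho>'" and iso: "rep_iso \<rho> \<rho>'"
    unfolding \<rho>'_def by (rule is_module_conjugate[OF \<rho> Q])+
  have d': "rdim \<rho>' = ?d" using iso by (simp add: rep_iso_def)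
  obtain e where e: "?d = r + e" using r le_Suc_ex by blast
  have "\<rho>' h $$ (r + i, j) = 0" if "i < e" "j < r" for h i j
  proof -
    have j: "j < ?d" and i: "r + i < ?d" using that r e by auto
    note c = module_carrier[OF \<rho>, of h]
    have Qc: "col Q j \<in> carrier_vec ?d" using Q(1) j by auto
    have "\<rho>' h $$ (r + i, j) = col (\<rho>' h) j $ (r + i)"
      using i j module_carrier[OF \<rho>', of h] unfolding d' by (metis carrier_matD index_col)
    also have "col (\<rho>' h) j = Q' *\<^sub>v (\<rho> h *\<^sub>v col Q j)"
      unfolding \<rho>'_def col_mult2[OF mult_carrier_mat[OF Q(2) c] Q(1) j]
      by (rule assoc_mult_mat_vec[OF Q(2) c Qc])
    also have "\<dots> $ (r + i) = 0"
    proof (rule lower[OF _ _ i])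
      show "\<rho> h *\<^sub>v col Q j \<in> W" using Wd cols[OF that(2)] by simp
    qed simp
    finally show ?thesis .
  qed
  then obtain \<alpha> \<gamma> where ag: "is_module \<alpha>" "is_module \<gamma>" "rdim \<alpha> = r" "rdim \<gamma> = e"
      "rep_iso \<rho>' (rep_sum \<alpha> \<gamma>)"
    using block_triangular_splits[OF \<rho>'] d' e by metis
  have "rep_iso \<rho> (rep_sum \<alpha> \<gamma>)"
    by (rule module_iso_trans[OF \<rho> \<rho>' is_module_rep_sum iso ag(5)]) (fact ag)+
  then show ?thesis
    using ag \<open>r \<noteq> 0\<close> \<open>r \<noteq> ?d\<close> e by (intro exI[of _ \<alpha>] exI[of _ \<gamma>]) simp
qed

text \<open>
  By induction on the dimension, splitting off proper submodules.  Characters and dimensions are carried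
  along, so that they need not be recovered from the equality in the representation ring.
\<close>

lemma decomposition:
  assumes "is_module \<rho>"
  shows "\<exists>Vs. (\<forall>V\<in>set Vs. simple_module V) \<and> rep_ring_eq (frag_of \<rho>) (\<Sum>V\<leftarrow>Vs. frag_of V) \<and>
    (\<forall>h. mat_trace (\<rho> h) = (\<Sum>V\<leftarrow>Vs. mat_trace (V h))) \<and> rdim \<rho> = (\<Sum>V\<leftarrow>Vs. rdim V)"
  using assms
proof (induction "rdim \<rho>" arbitrary: \<rho> rule: less_induct)
  case less
  note \<rho> = less.prems
  \<comment> \<open>A module of dimension \<open>0\<close> is not simple; it is the empty sum.\<close>
  consider "rdim \<rho> = 0" | "simple_module \<rho>" | W where "submodule \<rho> W"
      "W \<noteq> {0\<^sub>v (rdim \<rho>)}" "W \<noteq> carrier_vec (rdim \<rho>)"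
    unfolding simple_module_def using \<rho> by blast
  then show ?case
  proof cases
    case 1
    then show ?thesis
      using rep_ring_eq_zero_module[OF \<rho>] \<rho> by (intro exI[of _ "[]"]) (simp add: mat_trace_def)
  next
    case 2
    then show ?thesis by (intro exI[of _ "[\<rho>]"]) simp
  next
    case 3
    obtain \<alpha> \<gamma> where ag: "is_module \<alpha>" "is_module \<gamma>" "rdim \<alpha> < rdim \<rho>" "rdim \<gamma> < rdim \<rho>"
        and iso: "rep_iso \<rho> (rep_sum \<alpha> \<gamma>)"
      using submodule_splits[OF \<rho> 3] by blast
    obtain As where As: "\<forall>V\<in>set As. simple_module V" "rep_ring_eq (frag_of \<alpha>) (\<Sum>V\<leftarrow>As. frag_of V)"
      "\<forall>h. mat_trace (\<alpha> h) = (\<Sum>V\<leftarrow>As. mat_trace (V h))" "rdim \<alpha> = (\<Sum>V\<leftarrow>As. rdim V)"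
      using less.hyps[OF ag(3,1)] by blast
    obtain Cs where Cs: "\<forall>V\<in>set Cs. simple_module V" "rep_ring_eq (frag_of \<gamma>) (\<Sum>V\<leftarrow>Cs. frag_of V)"
      "\<forall>h. mat_trace (\<gamma> h) = (\<Sum>V\<leftarrow>Cs. mat_trace (V h))" "rdim \<gamma> = (\<Sum>V\<leftarrow>Cs. rdim V)"
      using less.hyps[OF ag(4,2)] by blast
    note s = is_module_rep_sum[OF ag(1,2)]
    have "rep_ring_eq (frag_of \<rho>) (frag_of (rep_sum \<alpha> \<gamma>))" by (rule rep_ring_eq_iso[OF \<rho> s iso])
    also have "rep_ring_eq \<dots> (frag_of \<alpha> + frag_of \<gamma>)" by (rule rep_ring_eq_rep_sum[OF ag(1,2)])
    also have "rep_ring_eq \<dots> ((\<Sum>V\<leftarrow>As. frag_of V) + (\<Sum>V\<leftarrow>Cs. frag_of V))"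
      by (rule rep_ring_eq_add[OF As(2) Cs(2)])
    finally have "rep_ring_eq (frag_of \<rho>) (\<Sum>V\<leftarrow>As @ Cs. frag_of V)" by simp
    moreover have "rdim \<rho> = rdim \<alpha> + rdim \<gamma>"
      using iso rdim_rep_sum[OF ag(1,2)] by (simp add: rep_iso_def)
    moreover have "mat_trace (\<rho> h) = mat_trace (\<alpha> h) + mat_trace (\<gamma> h)" for h
      using module_iso_trace[OF \<rho> s iso] trace_rep_sum[OF ag(1,2)] by simp
    ultimately show ?thesis
      using As Cs by (intro exI[of _ "As @ Cs"]) auto
  qed
qed

text \<open>
  A natural number because of complete reducibility, see \<open>multiplicity_left\<close>; it is unique in
  characteristic \<open>0\<close>.
\<close>

definition multiplicity :: "('h, 'k) rep \<Rightarrow> ('h, 'k) rep \<Rightarrow> nat" where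
  "multiplicity V \<rho> = (SOME c. of_nat c = pairing V \<rho>)"

text \<open>
  All four facts come from one decomposition of \<open>\<rho>\<close> into simple modules: by additivity and Schur's lemma,
  both pairings with \<open>V\<close> count the summands isomorphic to \<open>V\<close>.
\<close>

lemma
  assumes R: "transversal R" and \<rho>: "is_module \<rho>"
  shows rep_ring_eq_multiplicity:
      "rep_ring_eq (frag_of \<rho>) (\<Sum>V\<in>R. frag_cmul (int (multiplicity V \<rho>)) (frag_of V))"
    and rdim_eq_multiplicity: "rdim \<rho> = (\<Sum>V\<in>R. rdim V * multiplicity V \<rho>)"
    and multiplicity_left: "\<And>V. V \<in> R \<Longrightarrow> pairing V \<rho> = of_nat (multiplicity V \<rho>)"
    and multiplicity_right: "\<And>V. V \<in> R \<Longrightarrow> pairing \<rho> V = of_nat (multiplicity V \<rho>)"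
proof -
  note Rd = R[unfolded transversal_def]
  obtain Vs where Vs: "\<forall>V\<in>set Vs. simple_module V" "rep_ring_eq (frag_of \<rho>) (\<Sum>V\<leftarrow>Vs. frag_of V)"
    "\<And>h. mat_trace (\<rho> h) = (\<Sum>V\<leftarrow>Vs. mat_trace (V h))" "rdim \<rho> = (\<Sum>V\<leftarrow>Vs. rdim V)"
    using decomposition[OF \<rho>] by blast
  \<comment> \<open>\<open>c Ws V\<close> counts the members of \<open>Ws\<close> that are isomorphic to \<open>V\<close>.\<close>
  define c where "c Ws V = length (filter (\<lambda>W. rep_iso W V) Ws)" for Ws and V :: "('h, 'k) rep"
  have sm: "is_module V" if "simple_module V" for V using that by (simp add: simple_module_def)
  have iso_iff: "\<exists>V\<in>R. rep_iso W V \<and> (\<forall>U\<in>R. rep_iso W U \<longleftrightarrow> U = V)" if W: "simple_module W" for W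
  proof -
    obtain V where V: "V \<in> R" "rep_iso W V" using Rd W by blast
    moreover have "U = V" if U: "U \<in> R" "rep_iso W U" for U
    proof -
      have s: "is_module U" "is_module V" "is_module W" using U V W Rd sm by auto
      have "rep_iso U V"
        by (rule module_iso_trans[OF s(1,3,2) module_iso_sym[OF s(3,1) U(2)] V(2)])
      then show ?thesis using Rd U V by blast
    qed
    ultimately show ?thesis by blast
  qed
  have cons: "c (W # Ws) V = (if rep_iso W V then 1 else 0) + c Ws V" for W Ws V
    by (simp add: c_def)
  have count: "rep_ring_eq (\<Sum>V\<leftarrow>Vs. frag_of V) (\<Sum>V\<in>R. frag_cmul (int (c Vs V)) (frag_of V)) \<and>
    (\<Sum>V\<leftarrow>Vs. rdim V) = (\<Sum>V\<in>R. rdim V * c Vs V)"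
    using Vs(1)
  proof (induction Vs)
    case Nil
    then show ?case by (simp add: c_def)
  next
    case (Cons W Ws)
    then have W: "simple_module W" by simp
    obtain V where V: "V \<in> R" "rep_iso W V" "\<forall>U\<in>R. rep_iso W U \<longleftrightarrow> U = V" using iso_iff[OF W] by blast
    have Vm: "is_module V" using V Rd sm by auto
    have "frag_of V = (\<Sum>U\<in>R. if U = V then frag_of V else 0)" using V Rd by simp
    also have "\<dots> = (\<Sum>U\<in>R. frag_cmul (if rep_iso W U then 1 else 0) (frag_of U))"
      by (rule sum.cong) (use V in auto)
    finally have fV: "frag_of V = (\<Sum>U\<in>R. frag_cmul (if rep_iso W U then 1 else 0) (frag_of U))" .
    have "rdim W = rdim V" using V(2) by (simp add: rep_iso_def)
    also have "\<dots> = (\<Sum>U\<in>R. if U = V then rdim V else 0)" using V(1) Rd by simp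
    also have "\<dots> = (\<Sum>U\<in>R. rdim U * (if rep_iso W U then 1 else 0))"
      by (rule sum.cong) (use V in auto)
    finally have dW: "rdim W = (\<Sum>U\<in>R. rdim U * (if rep_iso W U then 1 else 0))" .
    have IH: "rep_ring_eq (\<Sum>V\<leftarrow>Ws. frag_of V) (\<Sum>V\<in>R. frag_cmul (int (c Ws V)) (frag_of V))"
      "(\<Sum>V\<leftarrow>Ws. rdim V) = (\<Sum>V\<in>R. rdim V * c Ws V)" using Cons by auto
    have "rep_ring_eq (frag_of W + (\<Sum>V\<leftarrow>Ws. frag_of V))
        (frag_of V + (\<Sum>V\<in>R. frag_cmul (int (c Ws V)) (frag_of V)))"
      by (rule rep_ring_eq_add[OF rep_ring_eq_iso[OF sm[OF W] Vm V(2)] IH(1)])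
    also have "frag_of V + (\<Sum>V\<in>R. frag_cmul (int (c Ws V)) (frag_of V)) =
        (\<Sum>V\<in>R. frag_cmul (int (c (W # Ws) V)) (frag_of V))"
      unfolding fV sum.distrib[symmetric] frag_cmul_distrib[symmetric]
      by (rule sum.cong) (auto simp: cons)
    finally show ?case
      using IH(2) dW by (simp add: cons distrib_left sum.distrib)
  qed
  have right: "pairing \<rho> V = of_nat (c Vs V)" if V: "V \<in> R" for V
  proof -
    have Vs': "simple_module V" using V Rd by blast
    have "(\<Sum>W\<leftarrow>Vs. pairing W V) = of_nat (c Vs V)"
      using Vs(1) by (induction Vs) (auto simp: c_def pairing_simple Vs')
    then show ?thesis using pairing_sum_left[OF Vs(3)] by simp
  qed
  have left: "pairing V \<rho> = of_nat (c Vs V)" if V: "V \<in> R" for V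
  proof -
    have Vs': "simple_module V" using V Rd by blast
    have "rep_iso V W \<longleftrightarrow> rep_iso W V" if "simple_module W" for W
      using module_iso_sym sm[OF that] sm[OF Vs'] by blast
    then have "(\<Sum>W\<leftarrow>Vs. pairing V W) = of_nat (c Vs V)"
      using Vs(1) by (induction Vs) (auto simp: c_def pairing_simple Vs')
    then show ?thesis using pairing_sum_right[OF Vs(3)] by simp
  qed
  have c: "c Vs V = multiplicity V \<rho>" if "V \<in> R" for V
    unfolding multiplicity_def left[OF that] of_nat_eq_iff by simp
  show "rep_ring_eq (frag_of \<rho>) (\<Sum>V\<in>R. frag_cmul (int (multiplicity V \<rho>)) (frag_of V))"
    using rep_ring_eq_trans[OF Vs(2)] count by (simp add: c)
  show "rdim \<rho> = (\<Sum>V\<in>R. rdim V * multiplicity V \<rho>)"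
    using Vs(4) count by (simp add: c)
  show "\<And>V. V \<in> R \<Longrightarrow> pairing V \<rho> = of_nat (multiplicity V \<rho>)"
    "\<And>V. V \<in> R \<Longrightarrow> pairing \<rho> V = of_nat (multiplicity V \<rho>)"
    by (simp_all add: left right c)
qed

end

section \<open>The regular module\<close>

context fin_dim_hopf_algebra
begin

lemma basis_list: "distinct basis_list" "independent (set basis_list)" "span (set basis_list) = UNIV"
proof -
  obtain B where B: "finite B" "span B = UNIV" using fin_dim by blast
  obtain B' where B': "B' \<subseteq> B" "independent B'" "B \<subseteq> span B'" using maximal_independent_subset by blast
  then have fin: "finite B'" using B(1) finite_subset by blast
  have "span B' = UNIV" using B(2) B'(3) by (metis span_mono span_span top.extremum_uniqueI)
  moreover obtain bs where "distinct bs" "set bs = B'" using finite_distinct_list[OF fin] by blast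
  ultimately have "\<exists>bs. distinct bs \<and> independent (set bs) \<and> span (set bs) = UNIV"
    using B'(2) by blast
  from someI_ex[OF this] show "distinct basis_list" "independent (set basis_list)"
    "span (set basis_list) = UNIV" unfolding basis_list_def by blast+
qed

abbreviation "hdim \<equiv> length basis_list"

abbreviation "bas i \<equiv> basis_list ! i"

definition coord :: "'h \<Rightarrow> nat \<Rightarrow> 'k" where
  "coord x i = representation (set basis_list) x (bas i)"

lemma coord_sum: "(\<Sum>i<hdim. scale (coord x i) (bas i)) = x"
proof -
  have "(\<Sum>i<hdim. scale (coord x i) (bas i)) =
      (\<Sum>b\<in>set basis_list. scale (representation (set basis_list) x b) b)"
    unfolding coord_def
    by (rule sum.reindex_bij_betw) (rule bij_betw_nth[OF basis_list(1)], auto)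
  also have "\<dots> = x"
    by (rule sum_representation_eq) (use basis_list in auto)
  finally show ?thesis .
qed

lemma coord_add: "coord (x + y) i = coord x i + coord y i"
  and coord_scale: "coord (scale c x) i = c * coord x i"
  unfolding coord_def using basis_list(2,3) by (simp_all add: representation_add representation_scale)

lemma coord_zero: "coord 0 i = 0"
  using coord_scale[of 0 0] by simp

lemma coord_of_sum: "coord (\<Sum>k\<in>K. x k) i = (\<Sum>k\<in>K. coord (x k) i)"
  by (induction K rule: infinite_finite_induct) (simp_all add: coord_zero coord_add)

lemma coord_basis: "i < hdim \<Longrightarrow> j < hdim \<Longrightarrow> coord (bas j) i = (if i = j then 1 else 0)"
  unfolding coord_def using basis_list(1,2)
  by (auto simp: representation_basis nth_eq_iff_index_eq)

lemma coord_mult: "coord (x * y) i = (\<Sum>k<hdim. coord y k * coord (x * bas k) i)"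
proof -
  have "coord (x * y) i = coord (x * (\<Sum>k<hdim. scale (coord y k) (bas k))) i" by (simp add: coord_sum)
  then show ?thesis
    by (simp add: sum_distrib_left coord_of_sum scale_mult_right coord_scale)
qed

lemma rdim_regular [simp]: "rdim regular = hdim"
  by (simp add: rdim_def regular_def)

lemma regular_entry: "i < hdim \<Longrightarrow> j < hdim \<Longrightarrow> regular h $$ (i, j) = coord (h * bas j) i"
  by (simp add: regular_def coord_def)

lemma is_module_regular: "is_module regular"
proof (rule is_moduleI)
  show "regular h \<in> carrier_mat hdim hdim" for h by (simp add: regular_def)
  fix x y i j assume ij: "i < hdim" "j < hdim"
  show "regular (x * y) $$ (i, j) = (\<Sum>k<hdim. regular x $$ (i, k) * regular y $$ (k, j))"
    using ij coord_mult[of x "y * bas j"] by (simp add: regular_entry mult.assoc mult.commute)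
qed (simp_all add: regular_entry distrib_right coord_add coord_basis scale_mult_left coord_scale)

lemma module_coord:
  assumes \<rho>: "is_module \<rho>" and i: "i < rdim \<rho>" and j: "j < rdim \<rho>"
  shows "\<rho> x $$ (i, j) = (\<Sum>k<hdim. coord x k * \<rho> (bas k) $$ (i, j))"
proof -
  have "\<rho> x $$ (i, j) = \<rho> (\<Sum>k<hdim. scale (coord x k) (bas k)) $$ (i, j)" by (simp add: coord_sum)
  then show ?thesis by (simp add: module_sum_entry[OF assms] module_scale[OF assms])
qed

end

context semisimple_hopf_algebra
begin

text \<open>
  A homomorphism from the regular module to \<open>U\<close> is determined by the image of \<open>1\<close>, which is arbitrary.
  So the averaging operator has the same image as the idempotent that sends \<open>P\<close> to the homomorphism
  \<open>x \<mapsto> x P(1)\<close>, whose trace is \<open>dim U\<close>.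
\<close>

lemma pairing_regular:
  assumes U: "is_module U"
  shows "pairing regular U = of_nat (rdim U)"
proof -
  let ?u = "rdim U"
  let ?I = "{..<?u} \<times> {..<hdim}"
  define A where "A = (\<lambda>(p, q) (i, j). averaging regular U p q i j)"
  \<comment> \<open>\<open>B\<close> is the idempotent \<open>P \<mapsto> (x \<mapsto> x P(1))\<close>.\<close>
  define B where "B = (\<lambda>(p, q) (i, j). U (bas q) $$ (p, i) * coord 1 j)"
  have homB: "hom_entries regular U (\<lambda>p q. U (bas q) $$ (p, i) * coord 1 j)" if i: "i < ?u" for i j
    unfolding hom_entries_def
  proof (intro allI impI)
    fix h p q assume p: "p < ?u" and q: "q < rdim regular"
    have "(\<Sum>k<?u. U h $$ (p, k) * (U (bas q) $$ (k, i) * coord 1 j)) = U (h * bas q) $$ (p, i) * coord 1 j"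
      by (simp add: module_mult[OF U p i] sum_distrib_right mult.assoc)
    also have "\<dots> = (\<Sum>k<rdim regular. U (bas k) $$ (p, i) * coord 1 j * regular h $$ (k, q))"
      using q unfolding module_coord[OF U p i, of "h * bas q"]
      by (simp add: sum_distrib_left sum_distrib_right regular_entry ac_simps)
    finally show "(\<Sum>k<?u. U h $$ (p, k) * (U (bas q) $$ (k, i) * coord 1 j)) =
      (\<Sum>k<rdim regular. U (bas k) $$ (p, i) * coord 1 j * regular h $$ (k, q))" .
  qed
  have sumI: "(\<Sum>y\<in>?I. f y) = (\<Sum>p<?u. \<Sum>q<hdim. f (p, q))" for f :: "_ \<Rightarrow> 'k"
    by (simp add: sum.cartesian_product)
  have "(\<Sum>x\<in>?I. A x x) = (\<Sum>x\<in>?I. B x x)"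
  proof (rule idempotent_trace_eq[of ?I A B])
    fix x z assume "x \<in> ?I" "z \<in> ?I"
    then obtain p q i j where x: "x = (p, q)" "p < ?u" "q < hdim" and z: "z = (i, j)" "i < ?u" "j < hdim"
      by auto
    show "(\<Sum>y\<in>?I. A x y * B y z) = B x z"
      using averaging_fixes_hom[OF is_module_regular homB[OF z(2)], of p q j] x
      by (simp add: A_def B_def z sumI)
    define P where "P p q = averaging regular U p q i j" for p q
    have homP: "hom_entries regular U P"
      unfolding P_def by (rule averaging_hom[OF is_module_regular U]) (use z in auto)
    have "(\<Sum>y\<in>?I. B x y * A y z) = (\<Sum>i<?u. \<Sum>j<hdim. U (bas q) $$ (p, i) * coord 1 j * P i j)"
      by (simp add: A_def B_def P_def x z sumI)
    also have "\<dots> = (\<Sum>j<hdim. coord 1 j * (\<Sum>i<?u. U (bas q) $$ (p, i) * P i j))"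
      by (subst sum.swap) (simp add: sum_distrib_left ac_simps)
    also have "\<dots> = (\<Sum>j<hdim. coord 1 j * (\<Sum>k<hdim. P p k * regular (bas q) $$ (k, j)))"
      using homP x unfolding hom_entries_def by simp
    also have "\<dots> = (\<Sum>k<hdim. P p k * (\<Sum>j<hdim. coord 1 j * coord (bas q * bas j) k))"
      unfolding sum_distrib_left by (subst sum.swap) (simp add: regular_entry ac_simps)
    also have "\<dots> = (\<Sum>k<hdim. if k = q then P p q else 0)"
      by (rule sum.cong) (use x in \<open>auto simp: coord_basis simp flip: coord_mult\<close>)
    also have "\<dots> = A x z" using x z by (simp add: P_def A_def)
    finally show "(\<Sum>y\<in>?I. B x y * A y z) = A x z" .
  qed
  moreover have "(\<Sum>x\<in>?I. A x x) = pairing regular U"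
    by (simp add: pairing_eq_trace_averaging is_module_regular U A_def sumI)
  moreover have "(\<Sum>x\<in>?I. B x x) = (\<Sum>p<?u. U 1 $$ (p, p))"
    using module_coord[OF U, of _ _ 1]
    by (simp add: B_def sumI mult.commute)
  ultimately show ?thesis by (simp add: module_one[OF U])
qed

lemma multiplicity_regular:
  assumes R: "transversal R" and V: "V \<in> R"
  shows "multiplicity V regular = rdim V"
proof -
  have "is_module V" using V R by (simp add: transversal_def simple_module_def)
  then have "(of_nat (multiplicity V regular) :: 'k) = of_nat (rdim V)"
    using multiplicity_right[OF R is_module_regular V] pairing_regular by simp
  then show ?thesis by simp
qed

end

section \<open>Tensor products and duals\<close>

context hopf_algebra
begin

lemma rdim_rep_tensor [simp]: "rdim (rep_tensor \<rho> \<sigma>) = rdim \<rho> * rdim \<sigma>"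
  by (simp add: rdim_def rep_tensor_def)

lemma rep_tensor_entry:
  assumes "is_module \<rho>" "is_module \<sigma>" "i < rdim \<rho>" "k < rdim \<rho>" "j < rdim \<sigma>" "l < rdim \<sigma>"
  shows "rep_tensor \<rho> \<sigma> h $$ (i * rdim \<sigma> + j, k * rdim \<sigma> + l) =
    sweedler h (\<lambda>a b. \<rho> a $$ (i, k) * \<sigma> b $$ (j, l))"
  using assms by (simp add: rep_tensor_def kronecker_def sweedler_def mult_add_less)

lemma is_module_rep_tensor:
  assumes \<rho>: "is_module \<rho>" and \<sigma>: "is_module \<sigma>"
  shows "is_module (rep_tensor \<rho> \<sigma>)"
proof (rule is_moduleI)
  let ?r = "rdim \<rho>" and ?s = "rdim \<sigma>"
  show "rep_tensor \<rho> \<sigma> h \<in> carrier_mat (?r * ?s) (?r * ?s)" for h by (simp add: rep_tensor_def)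
  fix p q assume "p < ?r * ?s" "q < ?r * ?s"
  then obtain i j k l where ijkl: "i < ?r" "k < ?r" "j < ?s" "l < ?s" 
      and p: "p = i * ?s + j" and q: "q = k * ?s + l"
    by (metis less_mult_split)
  note e = rep_tensor_entry[OF \<rho> \<sigma>]
  note bal = balanced_entries[OF \<rho> \<sigma> ijkl]
  show "rep_tensor \<rho> \<sigma> (x + y) $$ (p, q) = rep_tensor \<rho> \<sigma> x $$ (p, q) + rep_tensor \<rho> \<sigma> y $$ (p, q)" for x y
    unfolding p q e[OF ijkl] by (rule sweedler_add[OF bal])
  show "rep_tensor \<rho> \<sigma> (scale c x) $$ (p, q) = c * rep_tensor \<rho> \<sigma> x $$ (p, q)" for c x
    unfolding p q e[OF ijkl] sweedler_scale[OF bal]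
    by (simp add: module_scale[OF \<rho> ijkl(1,2)] mult.assoc sweedler_cmult)
  show "rep_tensor \<rho> \<sigma> 1 $$ (p, q) = (if p = q then 1 else 0)"
  proof -
    have "p = q \<longleftrightarrow> i = k \<and> j = l"
      unfolding p q using ijkl by (metis add.commute div_mult_self1 div_less mod_mult_self1 mod_less add_0 gr_implies_not0)
    then show ?thesis
      unfolding p q e[OF ijkl] sweedler_one[OF bal] by (simp add: module_one \<rho> \<sigma> ijkl)
  qed
  fix x y
  have "rep_tensor \<rho> \<sigma> (x * y) $$ (p, q) = sweedler x (\<lambda>a b. sweedler y (\<lambda>c d.
      (\<Sum>i'<?r. \<rho> a $$ (i, i') * \<rho> c $$ (i', k)) * (\<Sum>j'<?s. \<sigma> b $$ (j, j') * \<sigma> d $$ (j', l))))"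
    unfolding p q e[OF ijkl] sweedler_mult[OF bal]
    by (simp add: module_mult \<rho> \<sigma> ijkl)
  also have "\<dots> = (\<Sum>i'<?r. \<Sum>j'<?s. sweedler x (\<lambda>a b. sweedler y (\<lambda>c d.
      (\<rho> a $$ (i, i') * \<sigma> b $$ (j, j')) * (\<rho> c $$ (i', k) * \<sigma> d $$ (j', l)))))"
    unfolding sum_product sweedler_sum by (simp add: ac_simps)
  also have "\<dots> = (\<Sum>n<?r * ?s. rep_tensor \<rho> \<sigma> x $$ (p, n) * rep_tensor \<rho> \<sigma> y $$ (n, q))"
    unfolding p q sum_lessThan_mult
    by (intro sum.cong) (simp_all add: e ijkl sweedler_product)
  finally show "rep_tensor \<rho> \<sigma> (x * y) $$ (p, q) =
      (\<Sum>n<?r * ?s. rep_tensor \<rho> \<sigma> x $$ (p, n) * rep_tensor \<rho> \<sigma> y $$ (n, q))" .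
qed

text \<open>
  The left dual: the antipode turns the transposed right action into a left action.
\<close>

definition dual :: "('h, 'k) rep \<Rightarrow> ('h, 'k) rep" where
  "dual \<rho> h = transpose_mat (\<rho> (\<S> h))"

lemma dual_entry:
  assumes "is_module \<rho>" "i < rdim \<rho>" "j < rdim \<rho>"
  shows "dual \<rho> h $$ (i, j) = \<rho> (\<S> h) $$ (j, i)"
  using assms by (simp add: dual_def)

lemma rdim_dual [simp]: "is_module \<rho> \<Longrightarrow> rdim (dual \<rho>) = rdim \<rho>"
  unfolding rdim_def[of "dual \<rho>"] by (simp add: dual_def)

lemma is_module_dual:
  assumes \<rho>: "is_module \<rho>"
  shows "is_module (dual \<rho>)"
proof (rule is_moduleI[of _ "rdim \<rho>"])
  show "dual \<rho> h \<in> carrier_mat (rdim \<rho>) (rdim \<rho>)" for h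
    using module_carrier[OF \<rho>] by (simp add: dual_def)
qed (simp_all add: dual_entry \<rho> antipode_add antipode_scale antipode_mult antipode_one
    module_add module_scale module_mult module_one mult.commute)

text \<open>
  Twisting by a one-dimensional module is invertible, so \<open>M\<close> and the twisted module have the same
  submodules.
\<close>

lemma simple_module_twist:
  assumes M: "simple_module M" and X: "is_module X" and X1: "rdim X = 1"
  shows "simple_module (rep_tensor M X)"
proof -
  have Mm: "is_module M" and M0: "rdim M \<noteq> 0" using M by (auto simp: simple_module_def)
  let ?m = "rdim M" and ?T = "rep_tensor M X"
  have T: "is_module ?T" by (rule is_module_rep_tensor[OF Mm X])
  have dT: "rdim ?T = ?m" using X1 by simp
  \<comment> \<open>The action on \<open>M\<close> is recovered from the twisted one by the inverse twist, with \<open>X \<circ> \<S>\<close>.\<close>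
  have untwist: "M h $$ (i, k) = sweedler h (\<lambda>a b. ?T a $$ (i, k) * X (\<S> b) $$ (0, 0))"
    if ik: "i < ?m" "k < ?m" for h i k
  proof -
    have e: "?T a $$ (i, k) = sweedler a (\<lambda>a\<^sub>1 a\<^sub>2. M a\<^sub>1 $$ (i, k) * X a\<^sub>2 $$ (0, 0))" for a
      using rep_tensor_entry[OF Mm X ik, of 0 0] X1 by simp
    have "sweedler h (\<lambda>a b. ?T a $$ (i, k) * X (\<S> b) $$ (0, 0)) =
        sweedler h (\<lambda>a b. sweedler a (\<lambda>a\<^sub>1 a\<^sub>2. M a\<^sub>1 $$ (i, k) * X (a\<^sub>2 * \<S> b) $$ (0, 0)))"
      by (simp add: e module_mult[OF X] X1 mult.assoc flip: sweedler_cmult_right)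
    also have "\<dots> = M h $$ (i, k) * X 1 $$ (0, 0)"
      by (rule sweedler_split_antipode_right[OF balanced_entries[OF Mm X ik]]) (simp_all add: X1)
    finally show ?thesis by (simp add: module_one[OF X] X1)
  qed
  have "W = {0\<^sub>v ?m} \<or> W = carrier_vec ?m" if W: "submodule ?T W" for W
  proof -
    note Wd = W[unfolded submodule_def dT]
    have "M h *\<^sub>v w \<in> W" if w: "w \<in> W" for h w
    proof -
      have wc: "w \<in> carrier_vec ?m" using w Wd by blast
      have mem: "vec ?m (\<lambda>i. \<Sum>(a, b)\<leftarrow>xs. X (\<S> b) $$ (0, 0) * (?T a *\<^sub>v w) $ i) \<in> W" for xs
      proof (induction xs)
        case Nil
        have "vec ?m (\<lambda>i. \<Sum>(a, b)\<leftarrow>[]. X (\<S> b) $$ (0, 0) * (?T a *\<^sub>v w) $ i) = 0\<^sub>v ?m"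
          by (intro eq_vecI) auto
        then show ?case using Wd by simp
      next
        case (Cons ab xs)
        obtain a b where ab: "ab = (a, b)" by fastforce
        have "vec ?m (\<lambda>i. \<Sum>(a, b)\<leftarrow>ab # xs. X (\<S> b) $$ (0, 0) * (?T a *\<^sub>v w) $ i) =
          X (\<S> b) $$ (0, 0) \<cdot>\<^sub>v (?T a *\<^sub>v w) + vec ?m (\<lambda>i. \<Sum>(a, b)\<leftarrow>xs. X (\<S> b) $$ (0, 0) * (?T a *\<^sub>v w) $ i)"
          using T dT by (intro eq_vecI) (auto simp: ab)
        also have "\<dots> \<in> W" using Wd Cons w by simp
        finally show ?case .
      qed
      have "M h *\<^sub>v w = vec ?m (\<lambda>i. \<Sum>(a, b)\<leftarrow>\<Delta> h. X (\<S> b) $$ (0, 0) * (?T a *\<^sub>v w) $ i)"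
      proof (rule eq_vecI)
        fix i assume "i < dim_vec (vec ?m (\<lambda>i. \<Sum>(a, b)\<leftarrow>\<Delta> h. X (\<S> b) $$ (0, 0) * (?T a *\<^sub>v w) $ i))"
        then have i: "i < ?m" by simp
        note Tc = module_carrier[OF T, unfolded dT]
        have "(M h *\<^sub>v w) $ i = (\<Sum>k<?m. M h $$ (i, k) * w $ k)"
          by (rule index_mult_mat_vec_sum[OF module_carrier[OF Mm] wc i])
        also have "\<dots> = (\<Sum>k<?m. sweedler h (\<lambda>a b. ?T a $$ (i, k) * X (\<S> b) $$ (0, 0)) * w $ k)"
          using i untwist by simp
        also have "\<dots> = sweedler h (\<lambda>a b. X (\<S> b) $$ (0, 0) * (\<Sum>k<?m. ?T a $$ (i, k) * w $ k))"
          unfolding sum_distrib_left sweedler_sum sweedler_cmult_right[symmetric] by (simp add: ac_simps)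
        also have "\<dots> = sweedler h (\<lambda>a b. X (\<S> b) $$ (0, 0) * (?T a *\<^sub>v w) $ i)"
          by (simp only: index_mult_mat_vec_sum[OF Tc wc i])
        finally show "(M h *\<^sub>v w) $ i = vec ?m (\<lambda>i. \<Sum>(a, b)\<leftarrow>\<Delta> h. X (\<S> b) $$ (0, 0) * (?T a *\<^sub>v w) $ i) $ i"
          using i by (simp add: sweedler_def)
      qed (use Mm in simp)
      then show ?thesis using mem by simp
    qed
    then have "submodule M W" using Wd by (simp add: submodule_def)
    then show ?thesis using M by (simp add: simple_module_def)
  qed
  then show ?thesis using T M0 dT unfolding simple_module_def by simp
qed

text \<open>
  Brings together the two factors \<open>X\<close> and \<open>Y\<close>, which come from the coordinates of \<open>M\<close> in the two proofs of
  adjointness, so that they can be cancelled with the antipode.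
\<close>

lemma sweedler_rearrange:
  fixes c :: "'b \<Rightarrow> 'c \<Rightarrow> 'k"
  shows "sweedler h (\<lambda>a b. \<Sum>i\<in>A. X i a *
      (\<Sum>j\<in>B. \<Sum>l\<in>C. c j l * sweedler b (\<lambda>b\<^sub>1 b\<^sub>2. Y i j b\<^sub>1 * Z l b\<^sub>2))) =
    (\<Sum>j\<in>B. \<Sum>l\<in>C. c j l *
      sweedler h (\<lambda>a b. sweedler b (\<lambda>b\<^sub>1 b\<^sub>2. (\<Sum>i\<in>A. X i a * Y i j b\<^sub>1) * Z l b\<^sub>2)))"
  unfolding sum_rotate
  by (simp only: sum_distrib_right sweedler_sum mult.assoc sweedler_cmult)

text \<open>
  The adjunction between \<open>M\<^sup>* \<otimes> -\<close> and \<open>M \<otimes> -\<close>.  In terms of families \<open>P\<^sub>i : U \<rightarrow> V\<close>, a homomorphism from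
  \<open>M\<^sup>* \<otimes> U\<close> is the row of the \<open>P\<^sub>i\<close> and a homomorphism to \<open>M \<otimes> V\<close> is their column; only the position of the
  index \<open>i\<close> changes.  Equivariance carries over because \<open>h\<^sub>1 \<S> h\<^sub>2\<close> cancels in one direction and
  \<open>\<S> h\<^sub>1 h\<^sub>2\<close> in the other.
\<close>

lemma hom_adjoint_forward:
  assumes M: "is_module M" and U: "is_module U" and V: "is_module V"
    and hom: "hom_entries (rep_tensor (dual M) U) V P"
  shows "hom_entries U (rep_tensor M V) (\<lambda>p l. P (p mod rdim V) (p div rdim V * rdim U + l))"
  unfolding hom_entries_def rdim_rep_tensor
proof (intro allI impI)
  let ?m = "rdim M" and ?u = "rdim U" and ?v = "rdim V"
  fix h p l' assume "p < ?m * ?v" and l': "l' < ?u"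
  then obtain i j where i: "i < ?m" and j: "j < ?v" and p: "p = i * ?v + j"
    by (metis less_mult_split)
  note D = is_module_dual[OF M]
  have hom': "(\<Sum>j'<?v. V b $$ (j, j') * P j' (i' * ?u + l')) = (\<Sum>i\<^sub>2<?m. \<Sum>l<?u. P j (i\<^sub>2 * ?u + l) *
      sweedler b (\<lambda>b\<^sub>1 b\<^sub>2. M (\<S> b\<^sub>1) $$ (i', i\<^sub>2) * U b\<^sub>2 $$ (l, l')))" if i': "i' < ?m" for i' b
  proof -
    have "i' * ?u + l' < ?m * ?u" using i' l' by (rule mult_add_less)
    then have "(\<Sum>j'<?v. V b $$ (j, j') * P j' (i' * ?u + l')) =
        (\<Sum>k<?m * ?u. P j k * rep_tensor (dual M) U b $$ (k, i' * ?u + l'))"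
      using hom j M unfolding hom_entries_def by simp
    also have "\<dots> = (\<Sum>i\<^sub>2<?m. \<Sum>l<?u. P j (i\<^sub>2 * ?u + l) *
        sweedler b (\<lambda>b\<^sub>1 b\<^sub>2. dual M b\<^sub>1 $$ (i\<^sub>2, i') * U b\<^sub>2 $$ (l, l')))"
      unfolding sum_lessThan_mult using i' l' M
      by (intro sum.cong) (simp_all add: rep_tensor_entry[OF D U])
    finally show ?thesis using i' by (simp add: dual_entry M)
  qed
  have "(\<Sum>k<?m * ?v. rep_tensor M V h $$ (p, k) * P (k mod ?v) (k div ?v * ?u + l')) =
      (\<Sum>i'<?m. \<Sum>j'<?v. sweedler h (\<lambda>a b. M a $$ (i, i') * V b $$ (j, j')) * P j' (i' * ?u + l'))"
    unfolding sum_lessThan_mult p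
    by (intro sum.cong) (simp_all add: rep_tensor_entry M V i j)
  also have "\<dots> = sweedler h (\<lambda>a b. \<Sum>i'<?m. M a $$ (i, i') * (\<Sum>j'<?v. V b $$ (j, j') * P j' (i' * ?u + l')))"
    by (simp only: sweedler_sum sum_distrib_left sweedler_cmult_right mult.assoc[symmetric])
  also have "\<dots> = sweedler h (\<lambda>a b. \<Sum>i'<?m. M a $$ (i, i') * (\<Sum>i\<^sub>2<?m. \<Sum>l<?u. P j (i\<^sub>2 * ?u + l) *
      sweedler b (\<lambda>b\<^sub>1 b\<^sub>2. M (\<S> b\<^sub>1) $$ (i', i\<^sub>2) * U b\<^sub>2 $$ (l, l'))))"
    by (simp add: hom')
  also have "\<dots> = (\<Sum>i\<^sub>2<?m. \<Sum>l<?u. P j (i\<^sub>2 * ?u + l) * sweedler h (\<lambda>a b. sweedler b (\<lambda>b\<^sub>1 b\<^sub>2.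
      (\<Sum>i'<?m. M a $$ (i, i') * M (\<S> b\<^sub>1) $$ (i', i\<^sub>2)) * U b\<^sub>2 $$ (l, l'))))"
    by (rule sweedler_rearrange)
  also have "\<dots> = (\<Sum>i\<^sub>2<?m. \<Sum>l<?u. P j (i\<^sub>2 * ?u + l) * (M 1 $$ (i, i\<^sub>2) * U h $$ (l, l')))"
  proof (intro sum.cong refl arg_cong2[of _ _ _ _ "(*)"])
    fix i\<^sub>2 l assume "i\<^sub>2 \<in> {..<?m}" "l \<in> {..<?u}"
    then have il: "i\<^sub>2 < ?m" "l < ?u" by auto
    show "sweedler h (\<lambda>a b. sweedler b (\<lambda>b\<^sub>1 b\<^sub>2.
        (\<Sum>i'<?m. M a $$ (i, i') * M (\<S> b\<^sub>1) $$ (i', i\<^sub>2)) * U b\<^sub>2 $$ (l, l'))) = M 1 $$ (i, i\<^sub>2) * U h $$ (l, l')"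
      unfolding module_mult[OF M i il(1), symmetric]
      by (rule sweedler_cancel_right) (rule balanced_entries[OF M U i il l'])
  qed
  also have "\<dots> = (\<Sum>l<?u. \<Sum>i\<^sub>2<?m. if i\<^sub>2 = i then P j (i * ?u + l) * U h $$ (l, l') else 0)"
    by (subst sum.swap, intro sum.cong) (auto simp: module_one[OF M i])
  also have "\<dots> = (\<Sum>l<?u. P (p mod ?v) (p div ?v * ?u + l) * U h $$ (l, l'))"
    using i j by (simp add: p)
  finally show "(\<Sum>k<?m * ?v. rep_tensor M V h $$ (p, k) * P (k mod ?v) (k div ?v * ?u + l')) =
      (\<Sum>l<?u. P (p mod ?v) (p div ?v * ?u + l) * U h $$ (l, l'))" .
qed

lemma hom_adjoint_backward:
  assumes M: "is_module M" and U: "is_module U" and V: "is_module V"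
    and hom: "hom_entries U (rep_tensor M V) Q"
  shows "hom_entries (rep_tensor (dual M) U) V (\<lambda>j q. Q (q div rdim U * rdim V + j) (q mod rdim U))"
  unfolding hom_entries_def rdim_rep_tensor rdim_dual[OF M]
proof (intro allI impI)
  let ?m = "rdim M" and ?u = "rdim U" and ?v = "rdim V"
  fix h j q assume j: "j < ?v" and "q < ?m * ?u"
  then obtain i' l' where i': "i' < ?m" and l': "l' < ?u" and q: "q = i' * ?u + l'"
    by (metis less_mult_split)
  note D = is_module_dual[OF M]
  have hom': "(\<Sum>l<?u. Q (i * ?v + j) l * U b $$ (l, l')) = (\<Sum>i\<^sub>2<?m. \<Sum>j'<?v. Q (i\<^sub>2 * ?v + j') l' *
      sweedler b (\<lambda>b\<^sub>1 b\<^sub>2. M b\<^sub>1 $$ (i, i\<^sub>2) * V b\<^sub>2 $$ (j, j')))" if i: "i < ?m" for i b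
  proof -
    have "i * ?v + j < ?m * ?v" using i j by (rule mult_add_less)
    then have "(\<Sum>l<?u. Q (i * ?v + j) l * U b $$ (l, l')) =
        (\<Sum>k<?m * ?v. rep_tensor M V b $$ (i * ?v + j, k) * Q k l')"
      using hom l' unfolding hom_entries_def by simp
    also have "\<dots> = (\<Sum>i\<^sub>2<?m. \<Sum>j'<?v. Q (i\<^sub>2 * ?v + j') l' *
        sweedler b (\<lambda>b\<^sub>1 b\<^sub>2. M b\<^sub>1 $$ (i, i\<^sub>2) * V b\<^sub>2 $$ (j, j')))"
      unfolding sum_lessThan_mult using i j
      by (intro sum.cong) (simp_all add: rep_tensor_entry[OF M V] mult.commute)
    finally show ?thesis .
  qed
  have "(\<Sum>k<?m * ?u. Q (k div ?u * ?v + j) (k mod ?u) * rep_tensor (dual M) U h $$ (k, q)) =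
      (\<Sum>i<?m. \<Sum>l<?u. Q (i * ?v + j) l * sweedler h (\<lambda>a b. M (\<S> a) $$ (i', i) * U b $$ (l, l')))"
    unfolding sum_lessThan_mult q
    by (intro sum.cong) (simp_all add: rep_tensor_entry[OF D U] M i' l' dual_entry)
  also have "\<dots> = sweedler h (\<lambda>a b. \<Sum>i<?m. M (\<S> a) $$ (i', i) * (\<Sum>l<?u. Q (i * ?v + j) l * U b $$ (l, l')))"
    by (simp only: sum_distrib_left sweedler_sum) (simp add: sweedler_cmult[symmetric] ac_simps)
  also have "\<dots> = sweedler h (\<lambda>a b. \<Sum>i<?m. M (\<S> a) $$ (i', i) * (\<Sum>i\<^sub>2<?m. \<Sum>j'<?v. Q (i\<^sub>2 * ?v + j') l' *
      sweedler b (\<lambda>b\<^sub>1 b\<^sub>2. M b\<^sub>1 $$ (i, i\<^sub>2) * V b\<^sub>2 $$ (j, j'))))"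
    by (simp add: hom')
  also have "\<dots> = (\<Sum>i\<^sub>2<?m. \<Sum>j'<?v. Q (i\<^sub>2 * ?v + j') l' * sweedler h (\<lambda>a b. sweedler b (\<lambda>b\<^sub>1 b\<^sub>2.
      (\<Sum>i<?m. M (\<S> a) $$ (i', i) * M b\<^sub>1 $$ (i, i\<^sub>2)) * V b\<^sub>2 $$ (j, j'))))"
    by (rule sweedler_rearrange)
  also have "\<dots> = (\<Sum>i\<^sub>2<?m. \<Sum>j'<?v. Q (i\<^sub>2 * ?v + j') l' * (M 1 $$ (i', i\<^sub>2) * V h $$ (j, j')))"
  proof (intro sum.cong refl arg_cong2[of _ _ _ _ "(*)"])
    fix i\<^sub>2 j' assume "i\<^sub>2 \<in> {..<?m}" "j' \<in> {..<?v}"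
    then have il: "i\<^sub>2 < ?m" "j' < ?v" by auto
    show "sweedler h (\<lambda>a b. sweedler b (\<lambda>b\<^sub>1 b\<^sub>2.
        (\<Sum>i<?m. M (\<S> a) $$ (i', i) * M b\<^sub>1 $$ (i, i\<^sub>2)) * V b\<^sub>2 $$ (j, j'))) = M 1 $$ (i', i\<^sub>2) * V h $$ (j, j')"
      unfolding module_mult[OF M i' il(1), symmetric]
      by (rule sweedler_cancel_left) (rule balanced_entries[OF M V i' il(1) j il(2)])
  qed
  also have "\<dots> = (\<Sum>j'<?v. \<Sum>i\<^sub>2<?m. if i\<^sub>2 = i' then V h $$ (j, j') * Q (i' * ?v + j') l' else 0)"
    by (subst sum.swap, intro sum.cong) (auto simp: module_one[OF M i'])
  also have "\<dots> = (\<Sum>j'<?v. V h $$ (j, j') * Q (q div ?u * ?v + j') (q mod ?u))"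
    using i' l' by (simp add: q)
  finally show "(\<Sum>j'<?v. V h $$ (j, j') * Q (q div ?u * ?v + j') (q mod ?u)) =
    (\<Sum>k<?m * ?u. Q (k div ?u * ?v + j) (k mod ?u) * rep_tensor (dual M) U h $$ (k, q))" by simp
qed

end

context semisimple_hopf_algebra
begin

text \<open>
  By the adjunction, the averaging operators on both sides have the same image.
\<close>

lemma pairing_adjoint:
  assumes M: "is_module M" and U: "is_module U" and V: "is_module V"
  shows "pairing (rep_tensor (dual M) U) V = pairing U (rep_tensor M V)"
proof -
  let ?m = "rdim M" and ?u = "rdim U" and ?v = "rdim V"
  let ?I = "{..<?m} \<times> {..<?v} \<times> {..<?u}"
  let ?X = "rep_tensor (dual M) U" and ?Y = "rep_tensor M V"
  have X: "is_module ?X" by (intro is_module_rep_tensor is_module_dual M U)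
  have Y: "is_module ?Y" by (intro is_module_rep_tensor M V)
  have dX: "rdim ?X = ?m * ?u" and dY: "rdim ?Y = ?m * ?v" using M by simp_all
  \<comment> \<open>Both averaging operators act on families \<open>P\<^sub>i : U \<rightarrow> V\<close> indexed by the coordinates of \<open>M\<close>, flattened in two
    ways; they are written with the common index set of triples.\<close>
  define A where "A = (\<lambda>(i, j, l) (i', j', l'). averaging ?X V j (i * ?u + l) j' (i' * ?u + l'))"
  define B where "B = (\<lambda>(i, j, l) (i', j', l'). averaging U ?Y (i * ?v + j) l (i' * ?v + j') l')"
  have sumI: "(\<Sum>y\<in>?I. f y) = (\<Sum>i<?m. \<Sum>j<?v. \<Sum>l<?u. f (i, j, l))" for f :: "_ \<Rightarrow> 'k"
    by (simp add: sum.cartesian_product)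
  have "(\<Sum>x\<in>?I. A x x) = (\<Sum>x\<in>?I. B x x)"
  proof (rule idempotent_trace_eq[of ?I A B])
    fix x z assume "x \<in> ?I" "z \<in> ?I"
    then obtain i j l i' j' l' where x: "x = (i, j, l)" "i < ?m" "j < ?v" "l < ?u"
      and z: "z = (i', j', l')" "i' < ?m" "j' < ?v" "l' < ?u" by auto
    have b: "i * ?v + j < ?m * ?v" "i' * ?v + j' < ?m * ?v" "i * ?u + l < ?m * ?u" "i' * ?u + l' < ?m * ?u"
      using x z by (simp_all add: mult_add_less)
    show "(\<Sum>y\<in>?I. A x y * B y z) = B x z"
    proof -
      define Q where "Q p l = averaging U ?Y p l (i' * ?v + j') l'" for p l
      have "hom_entries U ?Y Q" unfolding Q_def by (rule averaging_hom[OF U Y]) (use b z dY in auto)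
      from averaging_fixes_hom[OF X hom_adjoint_backward[OF M U V this] x(3), of "i * ?u + l", unfolded dX]
      have "(\<Sum>j'<?v. \<Sum>q<?m * ?u. averaging ?X V j (i * ?u + l) j' q * Q (q div ?u * ?v + j') (q mod ?u)) =
          Q (i * ?v + j) l" using b x by simp
      then have "(\<Sum>j'<?v. \<Sum>i'<?m. \<Sum>l'<?u. averaging ?X V j (i * ?u + l) j' (i' * ?u + l') * Q (i' * ?v + j') l')
          = Q (i * ?v + j) l" by (simp add: sum_lessThan_mult)
      then show ?thesis
        unfolding sumI by (subst sum.swap) (simp add: A_def B_def Q_def x z)
    qed
    show "(\<Sum>y\<in>?I. B x y * A y z) = A x z"
    proof -
      define P where "P j q = averaging ?X V j q j' (i' * ?u + l')" for j q
      have "hom_entries ?X V P" unfolding P_def by (rule averaging_hom[OF X V]) (use b z dX in auto)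
      from averaging_fixes_hom[OF U hom_adjoint_forward[OF M U V this] _ x(4), of "i * ?v + j", unfolded dY]
      have "(\<Sum>p<?m * ?v. \<Sum>l'<?u. averaging U ?Y (i * ?v + j) l p l' * P (p mod ?v) (p div ?v * ?u + l')) =
          P j (i * ?u + l)" using b x by simp
      then have "(\<Sum>i'<?m. \<Sum>j'<?v. \<Sum>l'<?u. averaging U ?Y (i * ?v + j) l (i' * ?v + j') l' * P j' (i' * ?u + l'))
          = P j (i * ?u + l)" by (simp add: sum_lessThan_mult)
      then show ?thesis
        unfolding sumI by (simp add: A_def B_def P_def x z)
    qed
  qed
  moreover have "(\<Sum>x\<in>?I. A x x) = pairing ?X V"
    unfolding pairing_eq_trace_averaging[OF X V] dX sum_lessThan_mult sumI
    by (subst sum.swap) (simp add: A_def)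
  moreover have "(\<Sum>x\<in>?I. B x x) = pairing U ?Y"
    unfolding pairing_eq_trace_averaging[OF U Y] dY sum_lessThan_mult sumI
    by (simp add: B_def)
  ultimately show ?thesis by simp
qed

text \<open>
  By adjunction, \<open>[M \<otimes> V : U]\<close> is the multiplicity of \<open>V\<close> in \<open>M\<^sup>* \<otimes> U\<close>, whose dimension is
  \<open>dim M * dim U\<close>.
\<close>

lemma multiplicity_tensor_sum:
  assumes R: "transversal R" and M: "is_module M" and U: "U \<in> R"
  shows "(\<Sum>V\<in>R. rdim V * multiplicity U (rep_tensor M V)) = rdim M * rdim U"
proof -
  have m: "is_module V" if "V \<in> R" for V using that R by (simp add: transversal_def simple_module_def)
  let ?X = "rep_tensor (dual M) U"
  have X: "is_module ?X" by (rule is_module_rep_tensor[OF is_module_dual[OF M] m[OF U]])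
  have "multiplicity V ?X = multiplicity U (rep_tensor M V)" if V: "V \<in> R" for V
  proof -
    have "(of_nat (multiplicity V ?X) :: 'k) = of_nat (multiplicity U (rep_tensor M V))"
      using multiplicity_right[OF R X V] multiplicity_left[OF R is_module_rep_tensor[OF M m[OF V]] U]
        pairing_adjoint[OF M m[OF U] m[OF V]] by simp
    then show ?thesis by simp
  qed
  then show ?thesis using rdim_eq_multiplicity[OF R X] M by simp
qed

end

section \<open>The Knutson index\<close>

context hopf_algebra
begin

lemma rep_ring_mult_sum:
  "rep_ring_mult (frag_of M) (\<Sum>V\<in>R. frag_cmul (k V) (frag_of V)) =
    (\<Sum>V\<in>R. frag_cmul (k V) (frag_of (rep_tensor M V)))"
  unfolding rep_ring_mult_def frag_extend_of
  by (induction R rule: infinite_finite_induct) (simp_all add: frag_extend_add frag_extend_cmul)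

lemma virtual_module_sum:
  assumes "\<And>V. V \<in> R \<Longrightarrow> simple_module V"
  shows "virtual_module (\<Sum>V\<in>R. frag_cmul (k V) (frag_of V))"
  unfolding virtual_module_def
proof
  fix \<rho> assume "\<rho> \<in> Poly_Mapping.keys (\<Sum>V\<in>R. frag_cmul (k V) (frag_of V))"
  then have "\<rho> \<in> (\<Union>V\<in>R. Poly_Mapping.keys (frag_cmul (k V) (frag_of V)))"
    by (rule rev_subsetD[OF _ keys_sum])
  then show "simple_module \<rho>" using assms by (auto simp: keys_frag_of)
qed

end

context semisimple_hopf_algebra
begin

text \<open>
  The virtual module is \<open>\<Sum>V. k V V\<close>: its product with \<open>M\<close> has the multiplicities of the regular
  module.
\<close>

lemma knutson_index_eq_1I:
  assumes R: "transversal R" and M: "is_module M"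
    and k: "\<And>U. U \<in> R \<Longrightarrow> (\<Sum>V\<in>R. k V * multiplicity U (rep_tensor M V)) = rdim U"
  shows "knutson_index M = 1"
proof -
  define c where "c V U = multiplicity U (rep_tensor M V)" for U V
  have c: "rep_ring_eq (frag_of (rep_tensor M V)) (\<Sum>U\<in>R. frag_cmul (int (c V U)) (frag_of U))"
    if "V \<in> R" for V
  proof -
    have "is_module V" using that R by (simp add: transversal_def simple_module_def)
    then show ?thesis
      unfolding c_def by (intro rep_ring_eq_multiplicity R is_module_rep_tensor M)
  qed
  let ?N = "\<Sum>V\<in>R. frag_cmul (int (k V)) (frag_of V)"
  have "rep_ring_eq (rep_ring_mult (frag_of M) ?N)
      (\<Sum>V\<in>R. frag_cmul (int (k V)) (\<Sum>U\<in>R. frag_cmul (int (c V U)) (frag_of U)))"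
    unfolding rep_ring_mult_sum by (intro rep_ring_eq_sum rep_ring_eq_cmul c)
  also have "(\<Sum>V\<in>R. frag_cmul (int (k V)) (\<Sum>U\<in>R. frag_cmul (int (c V U)) (frag_of U))) =
      (\<Sum>U\<in>R. \<Sum>V\<in>R. frag_cmul (int (k V * c V U)) (frag_of U))"
    by (subst sum.swap) (simp add: frag_cmul_sum)
  also have "\<dots> = (\<Sum>U\<in>R. frag_cmul (int (\<Sum>V\<in>R. k V * c V U)) (frag_of U))"
  proof (rule sum.cong[OF refl])
    fix U :: "('h, 'k) rep"
    show "(\<Sum>V\<in>R. frag_cmul (int (k V * c V U)) (frag_of U)) =
        frag_cmul (int (\<Sum>V\<in>R. k V * c V U)) (frag_of U)"
      by (induction R rule: infinite_finite_induct) (simp_all add: frag_cmul_distrib)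
  qed
  also have "\<dots> = (\<Sum>U\<in>R. frag_cmul (int (rdim U)) (frag_of U))" by (simp add: k c_def)
  also have "rep_ring_eq \<dots> (frag_of regular)"
    using rep_ring_eq_sym[OF rep_ring_eq_multiplicity[OF R is_module_regular]]
    by (simp add: multiplicity_regular[OF R])
  finally have "rep_ring_eq (rep_ring_mult (frag_of M) ?N) (frag_of regular)" .
  moreover have "virtual_module ?N"
    using R by (intro virtual_module_sum) (simp add: transversal_def)
  ultimately show ?thesis
    unfolding knutson_index_def by (intro Least_equality) auto
qed

lemma knutson_index_dim_1:
  assumes R: "transversal R" and M: "is_module M" "rdim M = 1"
  shows "knutson_index M = 1"
proof -
  show ?thesis
    by (rule knutson_index_eq_1I[OF R M(1), of rdim]) (simp add: multiplicity_tensor_sum[OF R M(1)] M(2))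
qed

text \<open>
  The identity for \<open>\<Sum>V. dim V * [M \<otimes> V : U]\<close> shows that the number of one-dimensional \<open>X\<close> with
  \<open>M \<otimes> X \<cong> U\<close> is \<open>n\<close> times the part of \<open>dim U\<close> that the \<open>n\<close>-dimensional modules leave open.
\<close>

lemma knutson_index_dim_n:
  assumes R: "transversal (A \<union> B)" and A: "\<And>V. V \<in> A \<Longrightarrow> rdim V = 1"
    and B: "\<And>V. V \<in> B \<Longrightarrow> rdim V = n" and n: "n > 1"
    and M: "simple_module M" "rdim M = n"
  shows "knutson_index M = 1"
proof -
  note Rd = R[unfolded transversal_def]
  have fin: "finite A" "finite B" and disj: "A \<inter> B = {}" using Rd A B n by fastforce+
  have Mm: "is_module M" using M by (simp add: simple_module_def)
  have m: "is_module V" if "V \<in> A \<union> B" for V using that Rd by (simp add: simple_module_def)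
  define c where "c V U = multiplicity U (rep_tensor M V)" for U V
  have split: "(\<Sum>V\<in>A \<union> B. g V) = (\<Sum>V\<in>A. g V) + (\<Sum>V\<in>B. g V)" for g :: "_ \<Rightarrow> nat"
    by (rule sum.union_disjoint[OF fin disj])
  have simple: "simple_module (rep_tensor M X)" if "X \<in> A" for X
    by (rule simple_module_twist[OF M(1)]) (use that m A in auto)
  then have "\<forall>X\<in>A. \<exists>U\<in>A \<union> B. rep_iso (rep_tensor M X) U" using Rd by blast
  then obtain f where f: "\<And>X. X \<in> A \<Longrightarrow> f X \<in> A \<union> B \<and> rep_iso (rep_tensor M X) (f X)" by metis
  have cX: "c X U = (if f X = U then 1 else 0)" if X: "X \<in> A" and U: "U \<in> A \<union> B" for X U
  proof -
    have s: "is_module U" "is_module (f X)" "is_module (rep_tensor M X)"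
      using X U f m simple by (auto simp: simple_module_def)
    have "rep_iso U (rep_tensor M X) \<longleftrightarrow> rep_iso U (f X)"
      using f[OF X] module_iso_trans s module_iso_sym by metis
    also have "\<dots> \<longleftrightarrow> f X = U" using Rd U f[OF X] module_iso_refl[OF s(1)] by metis
    finally have "(of_nat (c X U) :: 'k) = of_nat (if f X = U then 1 else 0)"
      using multiplicity_left[OF R s(3) U] pairing_simple[OF _ simple[OF X], of U] U Rd
      by (auto simp: c_def)
    then show ?thesis using of_nat_eq_iff by blast
  qed
  \<comment> \<open>The divisibility that makes the construction possible: \<open>n\<close> divides \<open>card (D U)\<close>.\<close>
  define D where "D U = {X \<in> A. f X = U}" for U
  have count: "card (D U) + n * (\<Sum>V\<in>B. c V U) = n * rdim U" if U: "U \<in> A \<union> B" for U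
  proof -
    have "(\<Sum>V\<in>A. rdim V * c V U) = (\<Sum>X\<in>A. if f X = U then 1 else 0)"
      by (rule sum.cong) (simp_all add: A cX[OF _ U])
    also have "\<dots> = card (D U)" using fin by (simp add: D_def sum.If_cases Int_def)
    finally show ?thesis using multiplicity_tensor_sum[OF R Mm U]
      by (simp add: split B M(2) sum_distrib_left c_def)
  qed
  define g where "g U = (SOME X. X \<in> D U)" for U
  have g: "g U \<in> D U" if "D U \<noteq> {}" for U
    unfolding g_def using that by (simp add: some_in_eq)
  \<comment> \<open>Each nonempty \<open>D U\<close> is the fibre of \<open>f\<close> over \<open>U\<close>; its whole weight sits on the one member \<open>g U\<close>.\<close>
  define k where "k V = (if V \<in> B then 1 else if V = g (f V) then card (D (f V)) div n else 0)" for V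
  show ?thesis
  proof (rule knutson_index_eq_1I[OF R Mm, of k, folded c_def])
    fix U assume U: "U \<in> A \<union> B"
    have "(\<Sum>X\<in>A. k X * c X U) = (\<Sum>X\<in>A. if X = g U \<and> f X = U then card (D U) div n else 0)"
    proof (rule sum.cong[OF refl])
      fix X assume X: "X \<in> A"
      then have "X \<notin> B" using disj by blast
      then show "k X * c X U = (if X = g U \<and> f X = U then card (D U) div n else 0)"
        by (auto simp: cX[OF X U] k_def)
    qed
    also have "\<dots> = card (D U) div n"
    proof (cases "D U = {}")
      case True
      then have "f X \<noteq> U" if "X \<in> A" for X using that by (auto simp: D_def)
      then show ?thesis by (simp add: True)
    next
      case False
      then have "g U \<in> A" "f (g U) = U" using g[of U] by (auto simp: D_def)
      then have "(\<Sum>X\<in>A. if X = g U \<and> f X = U then card (D U) div n else 0) =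
          (\<Sum>X\<in>A. if X = g U then card (D U) div n else 0)"
        by (intro sum.cong) auto
      then show ?thesis using \<open>g U \<in> A\<close> fin by simp
    qed
    finally have "(\<Sum>V\<in>A \<union> B. k V * c V U) = card (D U) div n + (\<Sum>V\<in>B. c V U)"
      by (simp add: split k_def)
    also have "\<dots> = (card (D U) + n * (\<Sum>V\<in>B. c V U)) div n" using n by simp
    also have "\<dots> = rdim U" unfolding count[OF U] using n by simp
    finally show "(\<Sum>V\<in>A \<union> B. k V * c V U) = rdim U" .
  qed
qed

end

theorem theorem2p28:
  fixes scale :: "'k::{alg_closed_field, field_char_0} \<Rightarrow> 'h::ring_1 \<Rightarrow> 'h"
    and \<Delta> :: "'h \<Rightarrow> ('h \<times> 'h) list"
    and \<epsilon> :: "'h \<Rightarrow> 'k"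
    and \<S> :: "'h \<Rightarrow> 'h"
    and a n b :: nat
  assumes "fin_dim_hopf_algebra scale \<Delta> \<epsilon> \<S>"
    and "semisimple_ring TYPE('h)"
    and "n > 1"
    and "algebra_over.module_structure scale a n b"
  shows "hopf_algebra.knutson_type scale \<Delta>"
proof -
  interpret semisimple_hopf_algebra scale \<Delta> \<epsilon> \<S>
    using assms(1,2) by (simp add: semisimple_hopf_algebra_def semisimple_hopf_algebra_axioms_def)
  have fin: "finite (simple_classes 1)" "finite (simple_classes n)"
    and dims: "\<And>V. simple_module V \<Longrightarrow> rdim V = 1 \<or> rdim V = n"
    using assms(4) by (auto simp: module_structure_def)
  obtain A where A: "finite A" "\<And>V. V \<in> A \<Longrightarrow> simple_module V \<and> rdim V = 1"
    "\<And>V W. V \<in> A \<Longrightarrow> W \<in> A \<Longrightarrow> rep_iso V W \<Longrightarrow> V = W"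
    "\<And>V. simple_module V \<Longrightarrow> rdim V = 1 \<Longrightarrow> \<exists>W\<in>A. rep_iso V W"
    by (rule class_representatives[OF fin(1)]) (rule that)
  obtain B where B: "finite B" "\<And>V. V \<in> B \<Longrightarrow> simple_module V \<and> rdim V = n"
    "\<And>V W. V \<in> B \<Longrightarrow> W \<in> B \<Longrightarrow> rep_iso V W \<Longrightarrow> V = W"
    "\<And>V. simple_module V \<Longrightarrow> rdim V = n \<Longrightarrow> \<exists>W\<in>B. rep_iso V W"
    by (rule class_representatives[OF fin(2)]) (rule that)
  have iso_dim: "rdim V = rdim W" if "rep_iso V W" for V W :: "('h, 'k) rep"
    using that by (simp add: rep_iso_def)
  have R: "transversal (A \<union> B)"
    unfolding transversal_def
  proof (intro conjI ballI allI impI)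
    fix V W assume "V \<in> A \<union> B" "W \<in> A \<union> B" "rep_iso V W"
    then show "V = W" using iso_dim[of V W] A(2,3) B(2,3) assms(3) by fastforce
  next
    fix V assume "simple_module V"
    then show "\<exists>W\<in>A \<union> B. rep_iso V W" using dims A(4) B(4) by blast
  qed (use A B in auto)
  show ?thesis
    unfolding knutson_type_def
  proof (intro allI impI)
    fix M assume M: "simple_module M"
    then have Mm: "is_module M" by (simp add: simple_module_def)
    from dims[OF M] show "knutson_index M = 1"
    proof
      assume "rdim M = 1"
      then show ?thesis by (rule knutson_index_dim_1[OF R Mm])
    next
      assume "rdim M = n"
      show ?thesis
        by (rule knutson_index_dim_n[OF R _ _ assms(3) M \<open>rdim M = n\<close>]) (use A(2) B(2) in auto)
    qed
  qed
qed

end
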